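(* Let $\theta\in(0,1)$. Then there is a strictly increasing sequence $(n_k)_{k\ge1}$ of positive integers such that $\overline\triangle(\theta^{n_k},\theta^{2n_k})\cap\overline\triangle(\theta^{n_l},\theta^{2n_l})=\emptyset$ for all $k\ne l$, $\overline\triangle(\theta^{n_k},\theta^{2n_k})\subset\frac12\mathbb D$ for all $k$, and $$\sup\{R_D(z):z\in D\}=2,\qquad \inf\{R_D(z):z\in D\}=-\infty,$$ where $$D=\tfrac12\mathbb D\setminus\Big(\bigcup_{k=1}^\infty\overline\triangle(\theta^{n_k},\theta^{2n_k})\cup\{0\}\Big).$$
   Context: $\mathbb D$ is the open unit disc in $\mathbb C$, $\frac12\mathbb D=\{\lambda\in\mathbb C:|\lambda|<\frac12\}$, and $\overline\triangle(a,\rho)=\{\lambda\in\mathbb C:|\lambda-a|\le\rho\}$. For a bounded domain $D\subset\mathbb C$, let $L_h^2(D)$ be the space of square-integrable holomorphic functions on $D$ with its $L^2(D)$ norm. For $j=0,1,2,\dots$ and $z\in D$ put $$J_D^{(j)}(z)=\sup\{|f^{(j)}(z)|^2: f\in L_h^2(D),\ f(z)=\dots=f^{(j-1)}(z)=0,\ \|f\|_{L^2(D)}\le 1\}$$ (no vanishing condition when $j=0$). The sectional curvature of the Bergman metric of $D$ at $z$ is $$R_D(z)=2-\frac{J_D^{(0)}(z)\,J_D^{(2)}(z)}{J_D^{(1)}(z)^2}.$$ *)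

theory Defs
  imports "HOL-Complex_Analysis.Complex_Analysis"
begin

text \<open>
  Functions on a set \<open>D\<close> are represented by total functions; for open \<open>D\<close> nothing below depends
  on values outside \<open>D\<close>.
\<close>

definition L2_norm_on :: "complex set \<Rightarrow> (complex \<Rightarrow> complex) \<Rightarrow> real" where
  "L2_norm_on D f = sqrt (LINT w:D|lebesgue. (cmod (f w))\<^sup>2)"

definition L2h :: "complex set \<Rightarrow> (complex \<Rightarrow> complex) set" where
  "L2h D = {f. f holomorphic_on D \<and> set_integrable lebesgue D (\<lambda>w. (cmod (f w))\<^sup>2)}"

text \<open>
  For open \<open>D\<close> and \<open>z \<in> D\<close> the set below contains 0 and is bounded above by the Cauchy estimates,
  so the real-valued supremum is the true one.
\<close>

definition bergman_J :: "nat \<Rightarrow> complex set \<Rightarrow> complex \<Rightarrow> real" where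
  "bergman_J j D z =
     Sup {(cmod ((deriv ^^ j) f z))\<^sup>2 | f.
            f \<in> L2h D \<and> (\<forall>i<j. (deriv ^^ i) f z = 0) \<and> L2_norm_on D f \<le> 1}"

text \<open>
  For bounded open \<open>D\<close> and \<open>z \<in> D\<close> the denominator is positive, since \<open>w \<mapsto> w - z\<close> is square-integrable.
\<close>

definition bergman_curvature :: "complex set \<Rightarrow> complex \<Rightarrow> real" where
  "bergman_curvature D z =
     2 - bergman_J 0 D z * bergman_J 2 D z / (bergman_J 1 D z)\<^sup>2"

end

theory Submission
  imports Defs
begin

text \<open>
  Near a hole of radius \<open>r\<close> the function \<open>1/w\<close> (with \<open>w\<close> measured from the hole) has \<open>L\<^sup>2\<close> norm of order
  \<open>sqrt (ln (1/r))\<close>, while \<open>w\<^bsup>-2\<^esup>\<close> has norm of order \<open>1/r\<close>. At distance \<open>\<rho>\<close> from the hole with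
  \<open>r\<^bsup>1/3\<^esup> < \<rho> < ln (1/r)\<^bsup>-1/2\<^esup>\<close>, only 1 and \<open>1/w\<close> matter and \<open>J\<^sub>0 J\<^sub>2 / J\<^sub>1\<^sup>2\<close> is of order \<open>1 / ln (1/r)\<close>, so the curvature is
  almost 2. If \<open>\<rho>\<close> lies between \<open>r\<^bsup>2/3\<^esup>\<close> and \<open>r\<^bsup>1/2\<^esup>\<close>, then \<open>J\<^sub>1\<close> has to use \<open>w\<^bsup>-2\<^esup>\<close> too and is small, and the
  quotient is of order \<open>\<rho>\<^sup>6 r\<^bsup>-4\<^esup> / ln (1/r)\<close>, so the curvature is very negative. With \<open>r = p\<^bsup>16\<^esup>\<close> the distances
  \<open>\<rho> = p\<^sup>2\<close> and \<open>\<rho> = p\<^bsup>10\<^esup>\<close> are chosen. The lower bounds for the \<open>J\<^sub>j\<close> come from explicit test functions, the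
  upper bounds from splitting \<open>f\<close> on annuli into an inner and an outer holomorphic part. Making each hole
  extremely small compared with the previous one decouples the holes.
\<close>

subsection \<open>Pointwise bounds from the \<open>L\<^sup>2\<close> norm\<close>

lemma set_integral_mono_set:
  fixes f :: "'a \<Rightarrow> real"
  assumes "set_integrable M B f" "A \<in> sets M" "A \<subseteq> B" "\<And>x. x \<in> B \<Longrightarrow> 0 \<le> f x"
  shows "(LINT x:A|M. f x) \<le> (LINT x:B|M. f x)"
  using set_integrable_subset[OF assms(1-3)] assms
  unfolding set_lebesgue_integral_def set_integrable_def
  by (intro integral_mono) (auto simp: indicator_def)

lemma set_integrable_continuous_compact:
  fixes f :: "'a::euclidean_space \<Rightarrow> real"
  assumes "compact S" "continuous_on S f"
  shows "set_integrable lebesgue S f"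
  using borel_integrable_compact[OF assms] unfolding set_integrable_def
  by (simp add: integrable_completion)

text \<open>A sub-mean-value inequality for \<open>|f|^2\<close> with a crude constant. Its
  ingredients are Cauchy estimates and the area of a disc, so integration in polar coordinates is
  avoided.\<close>

lemma holomorphic_bound_by_L2:
  assumes hol: "f holomorphic_on cball z d" and d: "0 < d"
  shows "(cmod (f z))\<^sup>2 * d\<^sup>2 \<le> 400 * (LINT w:cball z d|lebesgue. (cmod (f w))\<^sup>2)"
proof (cases "f z = 0")
  case True
  then show ?thesis by (simp add: set_lebesgue_integral_def)
next
  case False
  txt \<open>At a maximum point \<open>v\<close> of \<open>|f w| (d - |z - w|)\<close> the Cauchy estimates keep \<open>|f|\<close> above half of
    \<open>|f v|\<close> on a disc of radius comparable to \<open>d - |z - v|\<close>.\<close>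
  have cont: "continuous_on (cball z d) f"
    using hol holomorphic_on_imp_continuous_on by blast
  have "continuous_on (cball z d) (\<lambda>w. cmod (f w) * (d - dist z w))"
    by (intro continuous_intros cont)
  then obtain v where v: "v \<in> cball z d"
    and vmax: "\<And>w. w \<in> cball z d \<Longrightarrow> cmod (f w) * (d - dist z w) \<le> cmod (f v) * (d - dist z v)"
    using continuous_attains_sup[of "cball z d" "\<lambda>w. cmod (f w) * (d - dist z w)"] d
    by (metis cball_eq_empty compact_cball not_less_iff_gr_or_eq)
  define A where "A = cmod (f v)"
  \<comment> \<open>The weight is \<open>2 * e\<close> at \<open>v\<close> and at least
    \<open>e\<close> on \<open>cball v e\<close>, so maximality gives \<open>|f| \<le> 2 * A\<close>
    there.\<close>
  define e where "e = (d - dist z v) / 2"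
  have m: "cmod (f z) * d \<le> 2 * e * A"
    using vmax[of z] d by (auto simp: A_def e_def algebra_simps)
  have "0 < cmod (f z) * d" using False d by simp
  with m have "0 < e * A" by linarith
  moreover have "0 \<le> A" by (simp add: A_def)
  ultimately have A: "0 < A" and e: "0 < e"
    by (auto simp: zero_less_mult_iff)
  have sub: "cball v e \<subseteq> cball z d" and far: "\<And>w. w \<in> cball v e \<Longrightarrow> e \<le> d - dist z w"
  proof -
    show 1: "e \<le> d - dist z w" if "w \<in> cball v e" for w
      using that dist_triangle[of z w v] by (auto simp: e_def field_simps)
    show "cball v e \<subseteq> cball z d" using 1 e by force
  qed
  have f2A: "cmod (f w) \<le> 2 * A" if w: "w \<in> cball v e" for w
  proof -
    have "cmod (f w) * e \<le> cmod (f w) * (d - dist z w)"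
      using far[OF w] by (simp add: mult_left_mono)
    also have "\<dots> \<le> cmod (f v) * (d - dist z v)"
      using vmax sub w by blast
    also have "\<dots> = (2 * A) * e" by (simp add: A_def e_def)
    finally show ?thesis using e by simp
  qed
  have hol_v: "f holomorphic_on ball v e"
    using hol sub by (meson ball_subset_cball holomorphic_on_subset order_trans)
  have der: "cmod (deriv f w) \<le> 4 * A / e" if w: "w \<in> ball v (e/2)" for w
  proof -
    have s: "cball w (e/2) \<subseteq> cball v e"
    proof
      fix y assume "y \<in> cball w (e/2)"
      then show "y \<in> cball v e"
        using w dist_triangle[of v y w] by auto
    qed
    have "cmod ((deriv ^^ 1) f w) \<le> fact 1 * (2 * A) / (e/2) ^ 1"
    proof (rule Cauchy_inequality)
      show "f holomorphic_on ball w (e/2)"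
        using hol s sub by (meson ball_subset_cball holomorphic_on_subset order_trans)
      show "continuous_on (cball w (e/2)) f"
        using cont s sub by (meson continuous_on_subset order_trans)
      show "cmod (f y) \<le> 2 * A" if "cmod (w - y) = e/2" for y
        using that s f2A[of y] by (auto simp: dist_norm)
    qed (use e in auto)
    then show ?thesis by simp
  qed
  \<comment> \<open>A move of at most \<open>e/8\<close> under the derivative bound
    \<open>4 * A / e\<close> changes \<open>f\<close> by at most \<open>A/2\<close>.\<close>
  have low: "A / 2 \<le> cmod (f w)" if w: "w \<in> cball v (e/8)" for w
  proof -
    have "cmod (f w - f v) \<le> (4 * A / e) * cmod (w - v)"
    proof (rule field_differentiable_bound[where S = "ball v (e/2)" and f' = "deriv f"])
      show "(f has_field_derivative deriv f y) (at y within ball v (e/2))" if "y \<in> ball v (e/2)" for y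
      proof (rule holomorphic_derivI[OF hol_v])
        show "y \<in> ball v e" using that e by auto
      qed auto
    qed (use der w e in auto)
    also have "\<dots> \<le> (4 * A / e) * (e/8)"
      using w A e by (intro mult_left_mono) (auto simp: dist_norm norm_minus_commute)
    also have "\<dots> = A/2" using e by simp
    finally show ?thesis unfolding A_def
      using norm_triangle_ineq2[of "f v" "f w"] by (simp add: norm_minus_commute)
  qed
  have s8: "cball v (e/8) \<subseteq> cball z d"
    using sub e by (intro order_trans[OF subset_cball[of "e/8" e]]) auto
  have meas: "measure lebesgue (cball v (e/8)) = pi * (e/8)\<^sup>2"
    using content_cball[of "e/8" v] e by (simp add: unit_ball_vol_2)
  have int: "set_integrable lebesgue (cball z d) (\<lambda>w. (cmod (f w))\<^sup>2)"
    by (intro set_integrable_continuous_compact continuous_intros cont) auto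
  have "(A/2)\<^sup>2 * (pi * (e/8)\<^sup>2) = (LINT w:cball v (e/8)|lebesgue. (A/2)\<^sup>2)"
    using emeasure_lborel_cball_finite[of v "e/8"] by (subst set_integral_const) (auto simp: meas)
  also have "\<dots> \<le> (LINT w:cball v (e/8)|lebesgue. (cmod (f w))\<^sup>2)"
    using low A by (intro set_integral_mono power_mono set_integrable_subset[OF int _ s8])
      (auto simp: set_integrable_continuous_compact)
  also have "\<dots> \<le> (LINT w:cball z d|lebesgue. (cmod (f w))\<^sup>2)"
    using s8 by (intro set_integral_mono_set[OF int]) auto
  finally have I: "(A/2)\<^sup>2 * (pi * (e/8)\<^sup>2) \<le> (LINT w:cball z d|lebesgue. (cmod (f w))\<^sup>2)" .
  have "(cmod (f z))\<^sup>2 * d\<^sup>2 = (cmod (f z) * d)\<^sup>2" by (simp add: power_mult_distrib)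
  also have "\<dots> \<le> (2 * e * A)\<^sup>2"
    using m d by (intro power_mono) auto
  also have "\<dots> = 4 * (e\<^sup>2 * A\<^sup>2)" by (simp add: power_mult_distrib)
  \<comment> \<open>Any constant above 1024/pi would do in place of 400.\<close>
  also have "\<dots> \<le> (400 / 256 * pi) * (e\<^sup>2 * A\<^sup>2)"
    using pi_gt3 by (intro mult_right_mono) auto
  also have "\<dots> = 400 * ((A/2)\<^sup>2 * (pi * (e/8)\<^sup>2))"
    by (simp add: power_divide)
  finally show ?thesis using I by linarith
qed

lemma L2_norm_on_le_1_iff:
  "L2_norm_on D f \<le> 1 \<longleftrightarrow> (LINT w:D|lebesgue. (cmod (f w))\<^sup>2) \<le> 1"
  by (simp add: L2_norm_on_def)

text \<open>Among \<open>N\<close> disjoint annuli of ratio 4, one carries at most \<open>1/N\<close> of the mass of \<open>|f|\<^sup>2\<close>. This yields the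
  logarithmic gain that is usually read off from the norm of \<open>1/w\<close> in polar coordinates.\<close>

lemma L2h_bound_on_annuli:
  assumes f: "f \<in> L2h D" and nrm: "L2_norm_on D f \<le> 1" and N: "0 < N" and s: "0 < s"
    and sub: "{w. s < cmod (w - c) \<and> cmod (w - c) < s * 4 ^ N} \<subseteq> D"
  obtains t where "s < t" "t < s * 4 ^ N"
    "\<And>w. cmod (w - c) = t \<Longrightarrow> (t * cmod (f w))\<^sup>2 * N \<le> 6400"
proof -
  have hol: "f holomorphic_on D" and int: "set_integrable lebesgue D (\<lambda>w. (cmod (f w))\<^sup>2)"
    using f by (auto simp: L2h_def)
  define A where "A = (\<lambda>i::nat. {w. s * 4 ^ i < cmod (w - c) \<and> cmod (w - c) < s * 4 ^ Suc i})"
  define m where "m = (\<lambda>i. LINT w:A i|lebesgue. (cmod (f w))\<^sup>2)"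
  have Aop: "open (A i)" for i
    unfolding A_def by (intro open_Collect_conj open_Collect_less continuous_intros)
  have Ameas: "A i \<in> sets lebesgue" for i using Aop[of i] by auto
  have AD: "A i \<subseteq> D" if "i < N" for i
  proof
    fix w assume w: "w \<in> A i"
    have "s * 4 ^ Suc i \<le> s * 4 ^ N" using that s by (intro mult_left_mono power_increasing) auto
    moreover have "s * 1 \<le> s * 4 ^ i" using s by (intro mult_left_mono one_le_power) auto
    ultimately show "w \<in> D" using w sub by (auto simp: A_def)
  qed
  have disj: "A i \<inter> A j = {}" if "i < j" for i j
  proof -
    have "s * 4 ^ Suc i \<le> s * 4 ^ j" using that s by (intro mult_left_mono power_increasing) auto
    then show ?thesis by (auto simp: A_def)
  qed
  have dis: "disjoint_family_on A {..<N}"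
    unfolding disjoint_family_on_def by (metis disj inf_commute linorder_neqE_nat)
  have intA: "set_integrable lebesgue (A i) (\<lambda>w. (cmod (f w))\<^sup>2)" if "i < N" for i
    using set_integrable_subset[OF int Ameas AD[OF that]] .
  have "(\<Sum>i<N. m i) = (LINT w:(\<Union>i<N. A i)|lebesgue. (cmod (f w))\<^sup>2)"
    unfolding m_def using Ameas intA by (intro set_integral_finite_Union[symmetric] dis) auto
  also have "\<dots> \<le> (LINT w:D|lebesgue. (cmod (f w))\<^sup>2)"
    using AD Ameas by (intro set_integral_mono_set[OF int]) auto
  also have "\<dots> \<le> 1" using nrm by (simp add: L2_norm_on_le_1_iff)
  finally have sum: "(\<Sum>i<N. m i) \<le> 1" .
  have "\<exists>i<N. m i \<le> 1 / N"
  proof (rule ccontr)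
    assume "\<not> ?thesis"
    then have "\<And>i. i < N \<Longrightarrow> 1 / N < m i" by auto
    then have "(\<Sum>i<N. 1 / real N) < (\<Sum>i<N. m i)"
      using N by (intro sum_strict_mono) auto
    then show False using sum N by simp
  qed
  then obtain i where i: "i < N" and mi: "m i * N \<le> 1" using N by (auto simp: field_simps)
  define r where "r = s * 4 ^ i"
  have r: "s \<le> r" "r * 4 \<le> s * 4 ^ N" "0 < r"
  proof -
    have "s * 4 ^ Suc i \<le> s * 4 ^ N" using i s by (intro mult_left_mono power_increasing) auto
    then show "r * 4 \<le> s * 4 ^ N" by (simp add: r_def)
    have "s * 1 \<le> s * 4 ^ i" using s by (intro mult_left_mono one_le_power) auto
    then show "s \<le> r" by (simp add: r_def)
  qed (use s in \<open>simp add: r_def\<close>)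
  \<comment> \<open>The circle of radius \<open>2 * r\<close> leaves room for discs of radius
    \<open>r/2\<close> inside the annulus from \<open>r\<close> to \<open>4 * r\<close>; rescaling
    gives 16 * 400 = 6400.\<close>
  show ?thesis
  proof
    show "s < 2 * r" "2 * r < s * 4 ^ N" using r s by auto
    show "(2 * r * cmod (f w))\<^sup>2 * N \<le> 6400" if w: "cmod (w - c) = 2 * r" for w
    proof -
      have c: "cball w (r/2) \<subseteq> A i"
      proof
        fix y assume "y \<in> cball w (r/2)"
        then have "cmod (w - y) \<le> r/2" by (simp add: dist_norm)
        then have "cmod (y - c) \<ge> 3/2 * r" "cmod (y - c) \<le> 5/2 * r"
          using w norm_triangle_ineq[of "w - y" "y - c"] norm_triangle_ineq[of "y - w" "w - c"]
          by (auto simp: norm_minus_commute)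
        then show "y \<in> A i" using r(3) unfolding A_def r_def by (auto simp: algebra_simps)
      qed
      have "(cmod (f w))\<^sup>2 * (r/2)\<^sup>2 \<le> 400 * (LINT w:cball w (r/2)|lebesgue. (cmod (f w))\<^sup>2)"
        using c AD[OF i] r(3) by (intro holomorphic_bound_by_L2 holomorphic_on_subset[OF hol]) auto
      also have "\<dots> \<le> 400 * m i"
        unfolding m_def using c by (intro mult_left_mono set_integral_mono_set[OF intA[OF i]]) auto
      finally have "(2 * r * cmod (f w))\<^sup>2 \<le> 6400 * m i"
        by (simp add: power_mult_distrib power_divide field_simps)
      then have "(2 * r * cmod (f w))\<^sup>2 * N \<le> (6400 * m i) * N"
        by (intro mult_right_mono) auto
      then show ?thesis using mi by linarith
    qed
  qed
qed

lemma L2h_pointwise_bound: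
  assumes f: "f \<in> L2h D" and nrm: "L2_norm_on D f \<le> 1" and sub: "cball z d \<subseteq> D" and d: "0 < d"
  shows "cmod (f z) \<le> 20 / d"
proof -
  have hol: "f holomorphic_on D" and int: "set_integrable lebesgue D (\<lambda>w. (cmod (f w))\<^sup>2)"
    using f by (auto simp: L2h_def)
  have "(cmod (f z))\<^sup>2 * d\<^sup>2 \<le> 400 * (LINT w:cball z d|lebesgue. (cmod (f w))\<^sup>2)"
    by (intro holomorphic_bound_by_L2 holomorphic_on_subset[OF hol] sub d)
  also have "\<dots> \<le> 400 * (LINT w:D|lebesgue. (cmod (f w))\<^sup>2)"
    using sub by (intro mult_left_mono set_integral_mono_set[OF int]) auto
  also have "\<dots> \<le> 20\<^sup>2" using nrm by (simp add: L2_norm_on_le_1_iff)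
  finally have "(cmod (f z) * d)\<^sup>2 \<le> 20\<^sup>2" by (simp add: power_mult_distrib)
  then have "cmod (f z) * d \<le> 20" by (rule power2_le_imp_le) simp
  then show ?thesis using d by (simp add: field_simps)
qed

subsection \<open>Splitting on an annulus\<close>

text \<open>The Cauchy kernel can be differentiated under the integral, so continuity of
  \<open>f\<close> on the circle suffices. The bound is the length estimate with
  \<open>|u - w|\<close> at least \<open>|r - |w - c||\<close>, and \<open>2 * pi\<close>
  cancels.\<close>

lemma Cauchy_type_integral_circlepath:
  fixes f :: "complex \<Rightarrow> complex"
  assumes cont: "continuous_on (sphere c r) f" and r: "0 < r"
  defines "C \<equiv> (\<lambda>w. contour_integral (circlepath c r) (\<lambda>u. f u / (u - w)) / (2 * of_real pi * \<i>))"
  shows "C holomorphic_on - sphere c r"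
    and "\<And>M w. \<lbrakk>\<And>u. cmod (u - c) = r \<Longrightarrow> cmod (f u) \<le> M; cmod (w - c) \<noteq> r\<rbrakk> \<Longrightarrow>
           cmod (C w) \<le> M * r / \<bar>r - cmod (w - c)\<bar>"
proof -
  define F where "F = (\<lambda>w. contour_integral (circlepath c r) (\<lambda>u. f u / (u - w)))"
  have ci: "((\<lambda>u. f u / (u - w)) has_contour_integral F w) (circlepath c r)" 
    if "w \<notin> sphere c r" for w
    unfolding F_def
  proof (intro has_contour_integral_integral contour_integrable_continuous_circlepath)
    show "continuous_on (path_image (circlepath c r)) (\<lambda>u. f u / (u - w))"
      using cont that r by (auto intro!: continuous_intros)
  qed
  have der: "(F has_field_derivative of_nat 1 * contour_integral (circlepath c r) (\<lambda>u. f u / (u-w)^(Suc 1))) (at w)"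
    if "w \<notin> sphere c r" for w
  proof (rule Cauchy_next_derivative(2)[where S = "- sphere c r" and B = "2 * pi * r"])
    show "continuous_on (path_image (circlepath c r)) f" using cont r by simp
    show "norm (vector_derivative (circlepath c r) (at t)) \<le> 2 * pi * r" for t
      using r by (simp add: vector_derivative_circlepath norm_mult)
    show "((\<lambda>u. f u / (u - y) ^ 1) has_contour_integral F y) (circlepath c r)"
      if "y \<in> - sphere c r - path_image (circlepath c r)" for y
      using ci[of y] that by simp
    show "w \<in> - sphere c r - path_image (circlepath c r)" using that r by simp
  qed auto
  have "F holomorphic_on - sphere c r"
    using der by (metis ComplD closed_sphere holomorphic_on_open open_Compl)
  then show "C holomorphic_on - sphere c r"
    unfolding C_def F_def by (intro holomorphic_intros) auto
  show "cmod (C w) \<le> M * r / \<bar>r - cmod (w - c)\<bar>"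
    if M: "\<And>u. cmod (u - c) = r \<Longrightarrow> cmod (f u) \<le> M" and w: "cmod (w - c) \<noteq> r" for M w
  proof -
    have "cmod (f (c + of_real r)) \<le> M" using r by (intro M) auto
    then have M0: "0 \<le> M" using norm_ge_zero order_trans by blast
    have "cmod (F w) \<le> M / \<bar>r - cmod (w - c)\<bar> * (2 * pi * r)"
    proof (rule has_contour_integral_bound_circlepath[OF ci])
      show "w \<notin> sphere c r" using w by (auto simp: dist_norm norm_minus_commute)
      show "cmod (f u / (u - w)) \<le> M / \<bar>r - cmod (w - c)\<bar>" if u: "cmod (u - c) = r" for u
      proof -
        have "\<bar>r - cmod (w - c)\<bar> \<le> cmod (u - w)"
          using norm_triangle_ineq3[of "u - c" "w - c"] u by simp
        then show ?thesis using w M[OF u] M0 by (auto simp: norm_divide intro!: frac_le)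
      qed
    qed (use M0 r in auto)
    then show ?thesis
      using r by (simp add: C_def F_def norm_divide norm_mult field_simps)
  qed
qed

text \<open>Laurent splitting without series: \<open>G\<close> is the Cauchy integral over the outer
  circle, \<open>h\<close> minus the one over the inner circle. Each part is bounded by the values
  of \<open>f\<close> on its own circle alone, so the two circles can be estimated by different
  means.\<close>

lemma holomorphic_annulus_decomposition:
  fixes f :: "complex \<Rightarrow> complex"
  assumes hol: "f holomorphic_on U" and U: "open U" and t: "0 < t" "t < T"
    and sub: "{w. t \<le> cmod (w - c) \<and> cmod (w - c) \<le> T} \<subseteq> U"
  obtains G h where "G holomorphic_on ball c T" "h holomorphic_on - cball c t"
    "\<And>w. \<lbrakk>t < cmod (w - c); cmod (w - c) < T\<rbrakk> \<Longrightarrow> f w = G w + h w"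
    "\<And>M w. \<lbrakk>\<And>u. cmod (u - c) = T \<Longrightarrow> cmod (f u) \<le> M; cmod (w - c) < T\<rbrakk> \<Longrightarrow>
       cmod (G w) \<le> M * T / (T - cmod (w - c))"
    "\<And>M w. \<lbrakk>\<And>u. cmod (u - c) = t \<Longrightarrow> cmod (f u) \<le> M; t < cmod (w - c)\<rbrakk> \<Longrightarrow>
       cmod (h w) \<le> M * t / (cmod (w - c) - t)"
proof -
  define C where "C = (\<lambda>r w. contour_integral (circlepath c r) (\<lambda>u. f u / (u - w)) / (2 * of_real pi * \<i>))"
  have fc: "continuous_on U f" using hol holomorphic_on_imp_continuous_on by blast
  have sp: "sphere c r \<subseteq> U" if "t \<le> r" "r \<le> T" for r
    using that sub by (force simp: dist_norm norm_minus_commute)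
  have cs: "continuous_on (sphere c r) f" if "t \<le> r" "r \<le> T" for r
    using continuous_on_subset[OF fc sp[OF that]] .
  have T: "0 < T" using t by simp
  note Cauchy = Cauchy_type_integral_circlepath
  have hol_C: "C r holomorphic_on - sphere c r"
    and C_bound: "\<And>M w. \<lbrakk>\<And>u. cmod (u - c) = r \<Longrightarrow> cmod (f u) \<le> M; cmod (w - c) \<noteq> r\<rbrakk> \<Longrightarrow>
           cmod (C r w) \<le> M * r / \<bar>r - cmod (w - c)\<bar>" if "t \<le> r" "r \<le> T" for r
    using Cauchy[OF cs[OF that]] that t unfolding C_def by auto
  show ?thesis
  proof
    show "C T holomorphic_on ball c T"
      by (rule holomorphic_on_subset[OF hol_C]) (use t in auto)
    show "(\<lambda>w. - C t w) holomorphic_on - cball c t"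
      by (intro holomorphic_on_minus holomorphic_on_subset[OF hol_C]) (use t in auto)
    show "cmod (C T w) \<le> M * T / (T - cmod (w - c))"
      if "\<And>u. cmod (u - c) = T \<Longrightarrow> cmod (f u) \<le> M" "cmod (w - c) < T" for M w
      using C_bound[of T M w] that t by auto
    show "cmod (- C t w) \<le> M * t / (cmod (w - c) - t)"
      if "\<And>u. cmod (u - c) = t \<Longrightarrow> cmod (f u) \<le> M" "t < cmod (w - c)" for M w
      using C_bound[of t M w] that t by auto
    show "f w = C T w + - C t w" if w: "t < cmod (w - c)" "cmod (w - c) < T" for w
    proof -
      \<comment> \<open>The difference quotient extends holomorphically over \<open>w\<close>, so
        its integrals over the two circles agree. The term with \<open>f w\<close> contributes
        \<open>2 * pi * i\<close> times \<open>f w\<close> on the outer circle and nothing on the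
        inner one.\<close>
      define F where "F = (\<lambda>u. if u = w then deriv f w else (f u - f w) / (u - w))"
      have F: "F holomorphic_on U" unfolding F_def by (rule pole_lemma_open[OF hol U])
      have 1: "((\<lambda>u. 1 / (u - w)) has_contour_integral 2 * of_real pi * \<i> * 1) (circlepath c T)"
        using w by (intro Cauchy_integral_circlepath) (auto simp: dist_norm norm_minus_commute)
      have 2: "((\<lambda>u. 1 / (u - w)) has_contour_integral 0) (circlepath c t)"
        using w t by (intro Cauchy_theorem_disc_simple[where a = c and e = "cmod (w - c)"])
          (auto intro!: holomorphic_intros simp: dist_norm norm_minus_commute)
      have eq: "contour_integral (circlepath c r) F =
          contour_integral (circlepath c r) (\<lambda>u. f u / (u - w)) -
          f w * contour_integral (circlepath c r) (\<lambda>u. 1 / (u - w))"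
        if r: "t \<le> r" "r \<le> T" "r \<noteq> cmod (w - c)" for r
      proof -
        have wr: "w \<notin> sphere c r" using r by (auto simp: dist_norm norm_minus_commute)
        have r0: "0 < r" using r t by simp
        have "contour_integral (circlepath c r) F =
            contour_integral (circlepath c r) (\<lambda>u. f u / (u - w) - f w * (1 / (u - w)))"
          using wr r0 by (intro contour_integral_cong) (auto simp: F_def diff_divide_distrib)
        also have "\<dots> = contour_integral (circlepath c r) (\<lambda>u. f u / (u - w)) -
            contour_integral (circlepath c r) (\<lambda>u. f w * (1 / (u - w)))"
          using wr r0 cs[of r] r
          by (intro contour_integral_diff contour_integrable_continuous_circlepath)
            (auto intro!: continuous_intros)
        also have "contour_integral (circlepath c r) (\<lambda>u. f w * (1 / (u - w))) =
            f w * contour_integral (circlepath c r) (\<lambda>u. 1 / (u - w))"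
          using wr r0 by (intro contour_integral_lmul contour_integrable_continuous_circlepath)
            (auto intro!: continuous_intros)
        finally show ?thesis .
      qed
      have "contour_integral (circlepath c t) F = contour_integral (circlepath c T) F"
      proof (rule Cauchy_theorem_homotopic_loops[OF _ U F])
        show "homotopic_loops U (circlepath c t) (circlepath c T)"
        proof (rule homotopic_loops_linear)
          fix x :: real
          show "closed_segment (circlepath c t x) (circlepath c T x) \<subseteq> U"
          proof
            fix y assume "y \<in> closed_segment (circlepath c t x) (circlepath c T x)"
            then obtain v where v: "0 \<le> v" "v \<le> 1"
              "y = (1 - v) *\<^sub>R circlepath c t x + v *\<^sub>R circlepath c T x"
              by (auto simp: closed_segment_def)
            \<comment> \<open>The segment joins points of equal argument, so it stays between the
              two radii.\<close>
            have "y - c = of_real ((1 - v) * t + v * T) * exp (2 * of_real pi * \<i> * of_real x)"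
              by (simp add: v(3) circlepath scaleR_conv_of_real algebra_simps)
            moreover have "cmod (exp (2 * of_real pi * \<i> * of_real x)) = 1"
              by simp
            moreover have "t \<le> (1 - v) * t + v * T" "(1 - v) * t + v * T \<le> T"
              using v t convex_bound_le[of t T T "1 - v" v] mult_left_mono[of t T v]
              by (auto simp: algebra_simps)
            ultimately have "t \<le> cmod (y - c)" "cmod (y - c) \<le> T"
              using t by (auto simp: norm_mult simp del: of_real_add of_real_mult of_real_diff)
            then show "y \<in> U" using sub by auto
          qed
        qed auto
      qed auto
      then have "contour_integral (circlepath c t) (\<lambda>u. f u / (u - w)) =
         contour_integral (circlepath c T) (\<lambda>u. f u / (u - w)) - f w * (2 * of_real pi * \<i>)"
        using eq[of t] eq[of T] w t contour_integral_unique[OF 1] contour_integral_unique[OF 2] by simp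
      then show ?thesis by (simp add: C_def diff_divide_distrib)
    qed
  qed
qed

subsection \<open>Extremal quantities and test functions\<close>

lemma set_integrable_bounded_continuous:
  fixes g :: "'a::euclidean_space \<Rightarrow> real"
  assumes D: "open D" "bounded D" and g: "continuous_on D g" "\<And>w. w \<in> D \<Longrightarrow> \<bar>g w\<bar> \<le> B"
  shows "set_integrable lebesgue D g"
proof (rule set_integrable_bound[where f = "\<lambda>_. B"])
  have "emeasure lebesgue D < \<infinity>"
    using emeasure_bounded_finite[OF D(2)] D(1) by simp
  then show "set_integrable lebesgue D (\<lambda>_. B)"
    using D by (auto simp: set_integrable_def)
  have "(\<lambda>x. indicator D x *\<^sub>R g x) \<in> borel_measurable borel"
    using D g by (intro borel_measurable_continuous_on_indicator) auto
  then show "set_borel_measurable lebesgue D g"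
    unfolding set_borel_measurable_def by (intro measurable_completion) simp
  show "AE w in lebesgue. w \<in> D \<longrightarrow> norm (g w) \<le> norm B"
    using g(2) by force
qed

lemma L2h_bounded_holomorphic:
  assumes D: "open D" "bounded D" and f: "f holomorphic_on D" "\<And>w. w \<in> D \<Longrightarrow> cmod (f w) \<le> B"
  shows "f \<in> L2h D"
proof -
  have "set_integrable lebesgue D (\<lambda>w. (cmod (f w))\<^sup>2)"
    using f by (intro set_integrable_bounded_continuous[OF D, where B = "B\<^sup>2"] continuous_intros
        holomorphic_on_imp_continuous_on) (auto intro!: power_mono)
  then show ?thesis using f by (simp add: L2h_def)
qed

text \<open>Without boundedness a real-valued \<open>Sup\<close> carries no information. On a disc
  of half the available radius the pointwise bound is uniform, and Cauchy estimates pass it on to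
  derivatives.\<close>

lemma bdd_above_bergman_J:
  assumes D: "open D" "z \<in> D"
  shows "bdd_above {(cmod ((deriv ^^ j) f z))\<^sup>2 | f.
            f \<in> L2h D \<and> (\<forall>i<j. (deriv ^^ i) f z = 0) \<and> L2_norm_on D f \<le> 1}"
proof -
  obtain e where e: "0 < e" "cball z e \<subseteq> D" using D open_contains_cball by metis
  define r where "r = e / 2"
  have r: "0 < r" using e by (simp add: r_def)
  have sub: "cball w r \<subseteq> D" if "w \<in> cball z r" for w
  proof
    fix y assume "y \<in> cball w r"
    then have "y \<in> cball z e" using that dist_triangle[of z y w] by (auto simp: r_def)
    then show "y \<in> D" using e by blast
  qed
  have zsub: "cball z r \<subseteq> D" using r by (intro sub) auto
  have "(cmod ((deriv ^^ j) f z))\<^sup>2 \<le> (fact j * (20 / r) / r ^ j)\<^sup>2"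
    if f: "f \<in> L2h D" "L2_norm_on D f \<le> 1" for f
  proof (intro power_mono Cauchy_inequality)
    have "f holomorphic_on D" using f by (simp add: L2h_def)
    then have h: "f holomorphic_on cball z r" using zsub holomorphic_on_subset by blast
    then show "f holomorphic_on ball z r" by (rule holomorphic_on_subset) auto
    show "continuous_on (cball z r) f" using h by (rule holomorphic_on_imp_continuous_on)
    show "cmod (f x) \<le> 20 / r" if "cmod (z - x) = r" for x
      using that by (intro L2h_pointwise_bound[OF f sub r]) (auto simp: dist_norm)
  qed (use r in auto)
  then show ?thesis by (auto intro!: bdd_aboveI)
qed

text \<open>Rescaling \<open>f\<close> by \<open>1 / sqrt M\<close> makes it admissible, so a test
  function needs only an upper bound \<open>M\<close> for its squared norm.\<close>

lemma bergman_J_ge: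
  assumes D: "open D" "z \<in> D" and f: "f \<in> L2h D" and van: "\<And>i. i < j \<Longrightarrow> (deriv ^^ i) f z = 0"
    and M: "(LINT w:D|lebesgue. (cmod (f w))\<^sup>2) \<le> M" "0 < M"
  shows "(cmod ((deriv ^^ j) f z))\<^sup>2 / M \<le> bergman_J j D z"
proof -
  define c where "c = complex_of_real (1 / sqrt M)"
  define g where "g = (\<lambda>w. c * f w)"
  have hol: "f holomorphic_on D" and int: "set_integrable lebesgue D (\<lambda>w. (cmod (f w))\<^sup>2)"
    using f by (auto simp: L2h_def)
  have c2: "(cmod c)\<^sup>2 = 1 / M" using M by (simp add: c_def norm_divide power_divide)
  have der: "(deriv ^^ i) g z = c * (deriv ^^ i) f z" for i
    unfolding g_def by (rule higher_deriv_cmult[OF hol D(2,1)])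
  have "g \<in> L2h D"
    using hol int by (auto simp: L2h_def g_def norm_mult power_mult_distrib intro!: holomorphic_intros)
  moreover have "\<forall>i<j. (deriv ^^ i) g z = 0" using van der by simp
  moreover have "L2_norm_on D g \<le> 1"
    unfolding L2_norm_on_le_1_iff using M by (simp add: g_def norm_mult power_mult_distrib c2)
  ultimately have "(cmod ((deriv ^^ j) g z))\<^sup>2 \<le> bergman_J j D z"
    unfolding bergman_J_def by (intro cSup_upper bdd_above_bergman_J[OF D]) auto
  then show ?thesis by (simp add: der norm_mult power_mult_distrib c2)
qed

lemma zero_in_L2h: "(\<lambda>_. 0) \<in> L2h D" "L2_norm_on D (\<lambda>_. 0) = 0"
  by (simp_all add: L2h_def L2_norm_on_def set_integrable_def set_lebesgue_integral_def)

lemma bergman_J_le: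
  assumes "\<And>f. \<lbrakk>f \<in> L2h D; \<And>i. i < j \<Longrightarrow> (deriv ^^ i) f z = 0; L2_norm_on D f \<le> 1\<rbrakk> \<Longrightarrow>
             (cmod ((deriv ^^ j) f z))\<^sup>2 \<le> B"
  shows "bergman_J j D z \<le> B"
  unfolding bergman_J_def
proof (rule cSup_least)
  \<comment> \<open>The zero function is always admissible, which gives the nonemptiness that
    bounding a real \<open>Sup\<close> from above requires.\<close>
  have "\<forall>i<j. (deriv ^^ i) (\<lambda>_. 0::complex) z = 0" by simp
  then show "{(cmod ((deriv ^^ j) f z))\<^sup>2 | f.
      f \<in> L2h D \<and> (\<forall>i<j. (deriv ^^ i) f z = 0) \<and> L2_norm_on D f \<le> 1} \<noteq> {}"
    using zero_in_L2h[of D] by force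
qed (use assms in auto)

lemma bergman_J_nonneg:
  assumes "open D" "z \<in> D"
  shows "0 \<le> bergman_J j D z"
  using bergman_J_ge[OF assms zero_in_L2h(1), of j 1] by (simp add: set_lebesgue_integral_def)

lemma bergman_curvature_le_2:
  assumes "open D" "z \<in> D"
  shows "bergman_curvature D z \<le> 2"
  unfolding bergman_curvature_def using bergman_J_nonneg[OF assms] by (simp add: divide_nonneg_nonneg)

text \<open>Splitting at the radii \<open>p ^ i\<close>; a power of \<open>1/p\<close> instead of the true logarithm is enough below.\<close>

lemma set_integral_inverse_square:
  assumes D: "open D" "D \<subseteq> ball a 1" and p: "0 < p" "p < 1"
    and far: "\<And>w. w \<in> D \<Longrightarrow> p ^ K \<le> cmod (w - a)"
  shows "set_integrable lebesgue D (\<lambda>w. 1 / (cmod (w - a))\<^sup>2)"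
    and "(LINT w:D|lebesgue. 1 / (cmod (w - a))\<^sup>2) \<le> 4 * real K / p\<^sup>2"
proof -
  have pos: "0 < cmod (w - a)" if "w \<in> D" for w
    using far[OF that] zero_less_power[OF p(1), of K] by linarith
  show int: "set_integrable lebesgue D (\<lambda>w. 1 / (cmod (w - a))\<^sup>2)"
  proof (rule set_integrable_bounded_continuous[OF D(1), where B = "1 / (p ^ K)\<^sup>2"])
    show "bounded D" using D bounded_ball bounded_subset by blast
    show "continuous_on D (\<lambda>w. 1 / (cmod (w - a))\<^sup>2)"
      using pos by (intro continuous_intros) force
    show "\<bar>1 / (cmod (w - a))\<^sup>2\<bar> \<le> 1 / (p ^ K)\<^sup>2" if "w \<in> D" for w
      using far[OF that] pos[OF that] p by (auto intro!: divide_left_mono power_mono)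
  qed
  \<comment> \<open>\<open>c i\<close> is the largest value of the integrand on the shell between
    radii \<open>p ^ Suc i\<close> and \<open>p ^ i\<close>. Using whole balls instead of shells
    still gives the same integral \<open>pi / p^2\<close> for every \<open>i\<close>.\<close>
  define c where "c = (\<lambda>i. 1 / (p ^ Suc i)\<^sup>2)"
  define S where "S = (\<lambda>w. \<Sum>i<K. c i * indicator (ball a (p ^ i)) w)"
  have Sint: "integrable lebesgue (\<lambda>w. c i * indicator (ball a (p ^ i)) w)" for i
    using emeasure_lborel_ball_finite[of a "p ^ i"] by (intro integrable_mult_right) auto
  have S0: "0 \<le> S w" for w unfolding S_def c_def by (intro sum_nonneg) auto
  have le: "1 / (cmod (w - a))\<^sup>2 \<le> S w" if w: "w \<in> D" for w
  proof -
    \<comment> \<open>The least \<open>j\<close> locates the shell of \<open>w\<close>; it is not 0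
      because \<open>D\<close> lies in the unit disc about \<open>a\<close>.\<close>
    define j where "j = (LEAST j. p ^ j \<le> cmod (w - a))"
    have j: "p ^ j \<le> cmod (w - a)" "j \<le> K"
      unfolding j_def using far[OF w] by (rule LeastI, rule Least_le)
    have "cmod (w - a) < 1" using w D by (auto simp: dist_norm norm_minus_commute)
    with j(1) have "j \<noteq> 0" by (intro notI) simp
    then obtain i where i: "j = Suc i" using not0_implies_Suc by blast
    have "\<not> p ^ i \<le> cmod (w - a)" using not_less_Least[of i] i unfolding j_def by (metis lessI)
    then have wi: "w \<in> ball a (p ^ i)" by (simp add: dist_norm norm_minus_commute)
    have "1 / (cmod (w - a))\<^sup>2 \<le> c i * indicator (ball a (p ^ i)) w"
      using j(1) i wi pos[OF w] p by (auto simp: c_def intro!: divide_left_mono power_mono)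
    also have "\<dots> \<le> S w" unfolding S_def c_def
      using j(2) i by (intro member_le_sum) auto
    finally show ?thesis .
  qed
  have "(LINT w:D|lebesgue. 1 / (cmod (w - a))\<^sup>2) \<le> (LINT w|lebesgue. S w)"
    unfolding set_lebesgue_integral_def
  proof (rule integral_mono)
    show "integrable lebesgue (\<lambda>w. indicator D w *\<^sub>R (1 / (cmod (w - a))\<^sup>2))"
      using int by (simp add: set_integrable_def)
    show "integrable lebesgue S" unfolding S_def using Sint by (intro Bochner_Integration.integrable_sum)
    show "indicator D w *\<^sub>R (1 / (cmod (w - a))\<^sup>2) \<le> S w" for w
      using le[of w] S0[of w] by (simp add: indicator_def)
  qed
  also have "\<dots> = (\<Sum>i<K. LINT w|lebesgue. c i * indicator (ball a (p ^ i)) w)"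
    unfolding S_def using Sint by (intro Bochner_Integration.integral_sum)
  also have "\<dots> = (\<Sum>i<K. c i * measure lebesgue (ball a (p ^ i)))"
    by (intro sum.cong) auto
  also have "\<dots> = (\<Sum>i<K. pi / p\<^sup>2)"
    using p by (intro sum.cong) (auto simp: content_ball unit_ball_vol_2 c_def power_mult_distrib)
  also have "\<dots> \<le> 4 * real K / p\<^sup>2"
    using pi_less_4 mult_right_mono[of pi 4 "real K"] by (simp add: divide_right_mono mult.commute)
  finally show "(LINT w:D|lebesgue. 1 / (cmod (w - a))\<^sup>2) \<le> 4 * real K / p\<^sup>2" .
qed

lemma measure_le_4:
  fixes a :: complex
  assumes "D \<in> sets lebesgue" "D \<subseteq> ball a 1"
  shows "measure lebesgue D \<le> 4"
proof -
  have "measure lebesgue D \<le> measure lebesgue (ball a 1)"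
    using assms by (intro measure_mono_fmeasurable) (auto simp: lmeasurable_ball)
  also have "\<dots> \<le> 4" using pi_less_4 by (simp add: content_ball unit_ball_vol_2)
  finally show ?thesis .
qed

subsection \<open>Domains with one dominant hole\<close>

text \<open>The hole has centre \<open>p ^ 8 = \<theta> ^ n\<close> and radius \<open>p ^ 16\<close>; all smaller holes lie in the disc of radius \<open>s\<close>,
  all larger ones outside the disc of radius \<open>\<delta>\<close>.\<close>

locale punctured_domain =
  fixes D :: "complex set" and a :: complex and p \<delta> s :: real
  assumes open_D: "open D" and D_sub: "D \<subseteq> ball 0 (1/2)"
    and a_def: "a = of_real (p ^ 8)"
    and p_pos: "0 < p" and p_small: "8 * p\<^sup>2 \<le> \<delta>" and \<delta>_le: "\<delta> \<le> 1/2"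
    and s_pos: "0 < s" and s_le: "s \<le> p ^ 8 / 4"
    and hole: "D \<inter> cball a (p ^ 16) = {}"
    and annulus: "\<And>w. \<lbrakk>s < cmod w; cmod w < \<delta>; w \<notin> cball a (p ^ 16)\<rbrakk> \<Longrightarrow> w \<in> D"
begin

text \<open>Collected so that later comparisons of scales become linear arithmetic in powers of
  \<open>p\<close>.\<close>

lemma p_bounds:
  shows "p\<^sup>2 \<le> 1/16" "p < 1" "p ^ 8 \<le> p\<^sup>2 / 4096" "p ^ 10 \<le> p ^ 8 / 16" "p ^ 16 \<le> p ^ 10 / 4096"
    "p ^ 8 \<le> 1 / 65536" "0 < p ^ 8" "0 < \<delta>" "p ^ 16 \<le> p ^ 8 / 65536" "p ^ 6 \<le> 1/4096" "0 < p ^ 16" "0 < p ^ 10"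
    "0 < p\<^sup>2"
proof -
  define q where "q = p\<^sup>2"
  have q: "0 < q" "q \<le> 1/16" using p_pos p_small \<delta>_le by (auto simp: q_def)
  have e: "p ^ 8 = q ^ 4" "p ^ 10 = q ^ 5" "p ^ 16 = q ^ 8" "p ^ 6 = q ^ 3"
    unfolding q_def by (simp_all flip: power_mult)
  have q3: "q ^ 3 \<le> (1/16) ^ 3" and q4: "q ^ 4 \<le> (1/16) ^ 4" using q by (intro power_mono; simp)+
  show "p\<^sup>2 \<le> 1/16" "0 < p\<^sup>2" using q by (auto simp: q_def)
  show "p < 1" using q p_pos power_less_one_iff[of p 2] by (simp add: q_def)
  have "q ^ 3 * q \<le> (1/16) ^ 3 * q" "q ^ 4 * q \<le> q ^ 4 * (1/16)"
      "q ^ 5 * q ^ 3 \<le> q ^ 5 * (1/16) ^ 3" "q ^ 4 * q ^ 4 \<le> q ^ 4 * (1/16) ^ 4"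
    using q q3 q4 by (intro mult_left_mono mult_right_mono; simp)+
  then show "p ^ 8 \<le> p\<^sup>2 / 4096" "p ^ 10 \<le> p ^ 8 / 16" "p ^ 16 \<le> p ^ 10 / 4096" "p ^ 16 \<le> p ^ 8 / 65536"
    unfolding e q_def[symmetric] by (simp_all add: power_one_over eval_nat_numeral)
  show "p ^ 8 \<le> 1 / 65536" "p ^ 6 \<le> 1/4096" unfolding e using q3 q4 by (simp_all add: power_one_over)
  show "0 < p ^ 8" "0 < p ^ 10" "0 < p ^ 16" using p_pos by auto
  show "0 < \<delta>" using q(1) p_small unfolding q_def by linarith
qed

lemma norm_a: "cmod a = p ^ 8"
  using p_pos by (simp add: a_def norm_power)

lemma bounded_D: "bounded D"
  using D_sub bounded_ball bounded_subset by blast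

lemma D_sub_ball: "D \<subseteq> ball a 1"
proof
  fix w assume "w \<in> D"
  then have "cmod w < 1/2" using D_sub by auto
  moreover have "cmod (a - w) \<le> p ^ 8 + cmod w"
    using norm_triangle_ineq4[of a w] norm_a by simp
  ultimately show "w \<in> ball a 1" using p_bounds by (simp add: dist_norm)
qed

lemma far_from_hole: "w \<in> D \<Longrightarrow> p ^ 16 \<le> cmod (w - a)"
  using hole by (auto simp: dist_norm norm_minus_commute disjoint_iff)

lemma far_from_hole': "w \<in> D \<Longrightarrow> w \<noteq> a"
  using far_from_hole[of w] p_bounds by auto

lemma norm_of_hole_point:
  assumes "w \<in> cball a (p ^ 16)"
  shows "p ^ 8 / 2 < cmod w" "cmod w < 2 * p ^ 8"
proof -
  have "cmod (a - w) \<le> p ^ 16" using assms by (simp add: dist_norm)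
  then show "p ^ 8 / 2 < cmod w" "cmod w < 2 * p ^ 8"
    using norm_triangle_ineq2[of a w] norm_triangle_ineq3[of a w] p_bounds(7,9) norm_a by linarith+
qed

lemma outer_annulus: "\<lbrakk>2 * p ^ 8 \<le> cmod w; cmod w < \<delta>\<rbrakk> \<Longrightarrow> w \<in> D"
  using norm_of_hole_point(2)[of w] s_le p_bounds(7) annulus[of w] by linarith

lemma inner_annulus: "\<lbrakk>s < cmod w; cmod w \<le> p ^ 8 / 2\<rbrakk> \<Longrightarrow> w \<in> D"
  using norm_of_hole_point(1)[of w] p_bounds(3,13) p_small annulus[of w] by linarith

lemma test_function_integrals:
  fixes c :: real
  shows "set_integrable lebesgue D (\<lambda>w. 1 / (cmod (w - a))\<^sup>2)"
    and "(LINT w:D|lebesgue. 1 / (cmod (w - a))\<^sup>2) \<le> 64 / p\<^sup>2"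
    and "set_integrable lebesgue D (\<lambda>w. c)"
    and "0 \<le> c \<Longrightarrow> (LINT w:D|lebesgue. c) \<le> 4 * c"
proof -
  \<comment> \<open>The hole has radius \<open>p ^ 16\<close>, so \<open>K = 16\<close> and the
    constant is 4 * 16 = 64.\<close>
  note I = set_integral_inverse_square[OF open_D D_sub_ball p_pos p_bounds(2) far_from_hole]
  show "set_integrable lebesgue D (\<lambda>w. 1 / (cmod (w - a))\<^sup>2)"
    "(LINT w:D|lebesgue. 1 / (cmod (w - a))\<^sup>2) \<le> 64 / p\<^sup>2" using I by simp_all
  show "set_integrable lebesgue D (\<lambda>w. c)"
    by (intro set_integrable_bounded_continuous[OF open_D bounded_D, of _ "\<bar>c\<bar>"]) auto
  have "emeasure lebesgue D \<noteq> \<infinity>"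
    using emeasure_bounded_finite[OF bounded_D] open_D by simp
  then have "(LINT w:D|lebesgue. c) = measure lebesgue D * c"
    using open_D by (subst set_integral_const) auto
  also have "\<dots> \<le> 4 * c" if "0 \<le> c"
    using measure_le_4[OF _ D_sub_ball] open_D that by (intro mult_right_mono) auto
  finally show "(LINT w:D|lebesgue. c) \<le> 4 * c" if "0 \<le> c" using that .
qed

text \<open>Every test function below is dominated by a combination of \<open>1 / |w - a|^2\<close>
  and a constant, whose integrals are already known.\<close>

lemma bergman_J_test:
  assumes z: "z \<in> D" and hol: "f holomorphic_on D"
    and bd: "\<And>w. w \<in> D \<Longrightarrow> (cmod (f w))\<^sup>2 \<le> \<alpha> * (1 / (cmod (w - a))\<^sup>2) + \<beta>"
    and van: "\<And>i. i < j \<Longrightarrow> (deriv ^^ i) f z = 0" and ab: "0 \<le> \<alpha>" "0 < \<beta>"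
  shows "(cmod ((deriv ^^ j) f z))\<^sup>2 / (64 * \<alpha> / p\<^sup>2 + 4 * \<beta>) \<le> bergman_J j D z"
proof (rule bergman_J_ge[OF open_D z _ van])
  have "cmod (f w) \<le> sqrt (\<alpha> * (1 / (p ^ 16)\<^sup>2) + \<beta>)" if w: "w \<in> D" for w
  proof (rule real_le_rsqrt)
    have "1 / (cmod (w - a))\<^sup>2 \<le> 1 / (p ^ 16)\<^sup>2"
      using far_from_hole[OF w] far_from_hole'[OF w] p_bounds(11) p_pos by (intro divide_left_mono power_mono) auto
    then show "(cmod (f w))\<^sup>2 \<le> \<alpha> * (1 / (p ^ 16)\<^sup>2) + \<beta>"
      using bd[OF w] mult_left_mono ab by (smt (verit))
  qed
  then show f: "f \<in> L2h D" by (rule L2h_bounded_holomorphic[OF open_D bounded_D hol])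
  have "(LINT w:D|lebesgue. (cmod (f w))\<^sup>2) \<le> (LINT w:D|lebesgue. \<alpha> * (1 / (cmod (w - a))\<^sup>2) + \<beta>)"
    using bd f test_function_integrals(1,3)
    by (intro set_integral_mono set_integral_add(1) set_integrable_mult_right) (auto simp: L2h_def)
  also have "\<dots> = \<alpha> * (LINT w:D|lebesgue. 1 / (cmod (w - a))\<^sup>2) + (LINT w:D|lebesgue. \<beta>)"
    using test_function_integrals(1,3) 
    by (subst set_integral_add(2)[OF set_integrable_mult_right]) (auto simp only: set_integral_mult_right)
  also have "\<dots> \<le> \<alpha> * (64 / p\<^sup>2) + 4 * \<beta>"
    using ab test_function_integrals(2,4) by (intro add_mono mult_left_mono) auto
  finally show "(LINT w:D|lebesgue. (cmod (f w))\<^sup>2) \<le> 64 * \<alpha> / p\<^sup>2 + 4 * \<beta>" by (simp add: mult.commute)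
  show "0 < 64 * \<alpha> / p\<^sup>2 + 4 * \<beta>" using ab by (intro add_nonneg_pos) auto
qed

text \<open>Makes the denominator of the curvature quotient positive; the test function is
  \<open>w - z\<close>.\<close>

lemma bergman_J1_pos:
  assumes z: "z \<in> D"
  shows "0 < bergman_J 1 D z"
proof -
  have d: "deriv (\<lambda>w. w - z) z = 1" by (rule DERIV_imp_deriv) (auto intro!: derivative_eq_intros)
  have "(cmod ((deriv ^^ 1) (\<lambda>w. w - z) z))\<^sup>2 / (64 * 0 / p\<^sup>2 + 4 * 1) \<le> bergman_J 1 D z"
  proof (rule bergman_J_test[OF z])
    show "(cmod (w - z))\<^sup>2 \<le> 0 * (1 / (cmod (w - a))\<^sup>2) + 1" if "w \<in> D" for w
    proof -
      have "cmod w < 1/2" "cmod z < 1/2" using that z D_sub by auto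
      then have "cmod (w - z) \<le> 1" using norm_triangle_ineq4[of w z] by linarith
      then show ?thesis by (simp add: power_le_one)
    qed
  qed (auto intro!: holomorphic_intros)
  then show ?thesis by (simp add: d)
qed

end

text \<open>At a zero of \<open>f'\<close> the second derivative of \<open>w * f w\<close> is just
  \<open>z\<close> times that of \<open>f\<close>.\<close>

lemma deriv2_times_id:
  assumes "f holomorphic_on S" "open S" "z \<in> S"
  shows "(deriv ^^ 2) (\<lambda>w. w * f w) z = z * (deriv ^^ 2) f z + 2 * deriv f z"
  using assms by (subst higher_deriv_mult[of _ S]) (auto simp: numeral_2_eq_2 algebra_simps)

subsection \<open>A point with curvature close to 2\<close>

context punctured_domain
begin

text \<open>The point lies on the side of 0 opposite to the hole, at distance
  \<open>p^2 + p^8\<close> from its centre.\<close>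

lemma outer_point:
  shows "- of_real (p\<^sup>2) \<in> D" "cmod (- of_real (p\<^sup>2)) = p\<^sup>2"
proof -
  show *: "cmod (- of_real (p\<^sup>2)) = p\<^sup>2" by (simp add: norm_power)
  show "- of_real (p\<^sup>2) \<in> D"
    using * p_bounds(3,13) p_small by (intro outer_annulus) linarith+
qed

lemma L2h_bound_outer_circle:
  assumes f: "f \<in> L2h D" "L2_norm_on D f \<le> 1" and w: "cmod w = \<delta> / 2"
  shows "cmod (f w) \<le> 80 / \<delta>"
proof -
  have "cball w (\<delta>/4) \<subseteq> D"
  proof
    fix y assume "y \<in> cball w (\<delta>/4)"
    then have "cmod (w - y) \<le> \<delta>/4" by (simp add: dist_norm)
    then show "y \<in> D"
      using w norm_triangle_ineq2[of w y] norm_triangle_ineq3[of w y] p_bounds(3,8,13) p_small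
      by (intro outer_annulus) linarith+
  qed
  then have "cmod (f w) \<le> 20 / (\<delta>/4)" using p_bounds(8) by (intro L2h_pointwise_bound[OF f]) auto
  then show ?thesis by simp
qed

text \<open>The outer part of \<open>f\<close> is of order \<open>1 / \<delta>\<close>. The inner
  part is controlled on a circle carrying little mass, found among \<open>N\<close> annuli, which
  yields the gain \<open>1 / N\<close>.\<close>

lemma outer_J0_le:
  assumes N: "0 < N" "4 ^ Suc N * p ^ 6 \<le> 1"
  shows "bergman_J 0 D (- of_real (p\<^sup>2)) * p ^ 4 \<le> 51200 * (1 / N + p ^ 4 / \<delta>\<^sup>2)"
proof -
  define z :: complex where "z = - of_real (p\<^sup>2)"
  have z: "cmod z = p\<^sup>2" unfolding z_def by (rule outer_point)
  \<comment> \<open>The condition on \<open>N\<close> lets all \<open>N\<close> annuli fit between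
    \<open>2 * p ^ 8\<close> and \<open>p^2 / 2\<close>.\<close>
  have sN: "(2 * p ^ 8) * 4 ^ N \<le> p\<^sup>2 / 2"
  proof -
    have "(4 ^ Suc N * p ^ 6) * p\<^sup>2 \<le> 1 * p\<^sup>2" using N by (intro mult_right_mono) auto
    moreover have "2 * p ^ 8 * 4 ^ N = (4 ^ Suc N * p ^ 6) * p\<^sup>2 / 2" by (simp flip: power_add)
    ultimately show ?thesis by linarith
  qed
  have "(cmod (f z))\<^sup>2 \<le> 51200 * (1 / N + p ^ 4 / \<delta>\<^sup>2) / p ^ 4"
    if f: "f \<in> L2h D" "L2_norm_on D f \<le> 1" for f
  proof -
    have "{w. 2 * p ^ 8 < cmod (w - 0) \<and> cmod (w - 0) < 2 * p ^ 8 * 4 ^ N} \<subseteq> D"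
    proof
      fix w assume "w \<in> {w. 2 * p ^ 8 < cmod (w - 0) \<and> cmod (w - 0) < 2 * p ^ 8 * 4 ^ N}"
      then have "2 * p ^ 8 < cmod w" "cmod w < 2 * p ^ 8 * 4 ^ N" by auto
      then show "w \<in> D" using sN p_small p_bounds(13) by (intro outer_annulus) linarith+
    qed
    then obtain t where t: "2 * p ^ 8 < t" "t < 2 * p ^ 8 * 4 ^ N"
      "\<And>w. cmod (w - 0) = t \<Longrightarrow> (t * cmod (f w))\<^sup>2 * N \<le> 6400"
      using L2h_bound_on_annuli[OF f N(1), of "2 * p ^ 8" 0] p_bounds(7) by auto
    have t0: "0 < t" using t(1) p_bounds(7) by linarith
    have t2: "t < p\<^sup>2 / 2" using t(2) sN by linarith
    have circ: "cmod (f w) \<le> 80 / sqrt N / t" if "cmod (w - 0) = t" for w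
    proof -
      have "(t * cmod (f w))\<^sup>2 \<le> 6400 / N" using t(3)[OF that] N by (simp add: field_simps)
      then have "t * cmod (f w) \<le> sqrt (6400 / N)" by (rule real_le_rsqrt)
      then show ?thesis using t0 by (subst pos_le_divide_eq) (simp_all add: real_sqrt_divide mult.commute)
    qed
    have hol: "f holomorphic_on D" using f by (simp add: L2h_def)
    have tT: "t < \<delta> / 2" using t2 p_small p_bounds(13) by linarith
    have sub: "{w. t \<le> cmod (w - 0) \<and> cmod (w - 0) \<le> \<delta> / 2} \<subseteq> D"
      using t(1) p_bounds(8) by (auto intro!: outer_annulus)
    obtain G h where
      eq: "\<And>w. \<lbrakk>t < cmod (w - 0); cmod (w - 0) < \<delta> / 2\<rbrakk> \<Longrightarrow> f w = G w + h w"
      and G: "\<And>M w. \<lbrakk>\<And>u. cmod (u - 0) = \<delta> / 2 \<Longrightarrow> cmod (f u) \<le> M; cmod (w - 0) < \<delta> / 2\<rbrakk> \<Longrightarrow>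
         cmod (G w) \<le> M * (\<delta> / 2) / (\<delta> / 2 - cmod (w - 0))"
      and h: "\<And>M w. \<lbrakk>\<And>u. cmod (u - 0) = t \<Longrightarrow> cmod (f u) \<le> M; t < cmod (w - 0)\<rbrakk> \<Longrightarrow>
         cmod (h w) \<le> M * t / (cmod (w - 0) - t)"
      by (rule holomorphic_annulus_decomposition[OF hol open_D t0 tT sub]) blast
    have zT: "cmod (z - 0) < \<delta> / 2" "cmod (z - 0) \<le> \<delta> / 4"
      using z p_small p_bounds(13) unfolding diff_zero by linarith+
    have "cmod (G z) \<le> (80 / \<delta>) * (\<delta> / 2) / (\<delta> / 2 - cmod (z - 0))"
      using L2h_bound_outer_circle[OF f] by (intro G zT) auto
    also have "\<dots> \<le> (80 / \<delta>) * (\<delta> / 2) / (\<delta> / 4)"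
      using zT p_bounds(8) by (intro divide_left_mono mult_pos_pos) auto
    also have "\<dots> = 160 / \<delta>" using p_bounds(8) by simp
    finally have Gz: "(cmod (G z))\<^sup>2 \<le> (160 / \<delta>)\<^sup>2" by (intro power_mono) auto
    have zt: "t < cmod (z - 0)" "p\<^sup>2 / 2 \<le> cmod (z - 0) - t"
      using z t2 p_bounds(13) unfolding diff_zero by linarith+
    \<comment> \<open>The uncontrolled radius \<open>t\<close> cancels: \<open>f\<close> is of order
      \<open>1 / t\<close> on the circle, and \<open>h\<close> decays like
      \<open>t / |w|\<close>.\<close>
    have "cmod (h z) \<le> (80 / sqrt N / t) * t / (cmod (z - 0) - t)"
      using zt circ by (intro h) auto
    also have "\<dots> \<le> (80 / sqrt N / t) * t / (p\<^sup>2 / 2)"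
      using zt t0 p_bounds(13) by (intro divide_left_mono mult_pos_pos) auto
    also have "\<dots> = 160 / (sqrt N * p\<^sup>2)" using t0 by simp
    finally have "(cmod (h z))\<^sup>2 \<le> (160 / (sqrt N * p\<^sup>2))\<^sup>2" by (intro power_mono) auto
    then have hz: "(cmod (h z))\<^sup>2 \<le> 25600 / (N * p ^ 4)"
      by (simp add: power_divide power_mult_distrib flip: power_mult)
    have "(cmod (f z))\<^sup>2 \<le> (cmod (G z) + cmod (h z))\<^sup>2"
      using eq[OF zt(1) zT(1)] norm_triangle_ineq[of "G z" "h z"]
      by (intro power_mono) auto
    also have "\<dots> \<le> 2 * (cmod (G z))\<^sup>2 + 2 * (cmod (h z))\<^sup>2"
      using sum_squares_bound[of "cmod (G z)" "cmod (h z)"] by (simp add: power2_sum)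
    also have "\<dots> \<le> 2 * (160 / \<delta>)\<^sup>2 + 2 * (25600 / (N * p ^ 4))" using Gz hz by linarith
    also have "\<dots> = 51200 * (1 / N + p ^ 4 / \<delta>\<^sup>2) / p ^ 4"
      using p_pos p_bounds(8) N by (simp add: field_simps)
    finally show ?thesis .
  qed
  then have "bergman_J 0 D z \<le> 51200 * (1 / N + p ^ 4 / \<delta>\<^sup>2) / p ^ 4"
    by (intro bergman_J_le) auto
  then show ?thesis using p_pos by (simp add: z_def pos_le_divide_eq)
qed

lemma outer_J2_le:
  "bergman_J 2 D (- of_real (p\<^sup>2)) * p ^ 4 \<le> (10240 * (1 + 1 / \<delta>\<^sup>2))\<^sup>2"
proof -
  define z :: complex where "z = - of_real (p\<^sup>2)"
  have z: "cmod z = p\<^sup>2" "z \<in> D" unfolding z_def by (rule outer_point)+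
  define K where "K = 10240 * (1 + 1 / \<delta>\<^sup>2)"
  have "(cmod ((deriv ^^ 2) f z))\<^sup>2 \<le> K\<^sup>2 / p ^ 4"
    if f: "f \<in> L2h D" "L2_norm_on D f \<le> 1" and van: "\<And>i. i < 2 \<Longrightarrow> (deriv ^^ i) f z = 0" for f
  proof -
    have hol: "f holomorphic_on D" using f by (simp add: L2h_def)
    txt \<open>Multiplication by \<open>w\<close> removes the weak singularity \<open>1/w\<close>, the only one not controlled by the small hole.\<close>
    define g where "g = (\<lambda>w. w * f w)"
    have holg: "g holomorphic_on D" unfolding g_def by (intro holomorphic_intros hol)
    \<comment> \<open>Discs of radius \<open>p ^ 8\<close> about points of this circle avoid the
      hole and everything inside it, so \<open>|f| \<le> 20 / p ^ 8\<close> and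
      \<open>|g| \<le> 80\<close> there.\<close>
    define t where "t = 4 * p ^ 8"
    have t: "0 < t" "t < \<delta> / 2" "t \<le> p\<^sup>2 / 4"
      using p_bounds(3,7,8,13) p_small unfolding t_def by linarith+
    have sub: "{w. t \<le> cmod (w - 0) \<and> cmod (w - 0) \<le> \<delta> / 2} \<subseteq> D"
    proof
      fix w assume "w \<in> {w. t \<le> cmod (w - 0) \<and> cmod (w - 0) \<le> \<delta> / 2}"
      then have "t \<le> cmod w" "cmod w \<le> \<delta> / 2" by auto
      then show "w \<in> D" using p_bounds(7,8) unfolding t_def by (intro outer_annulus) linarith+
    qed
    have circ_t: "cmod (g w) \<le> 80" if w: "cmod (w - 0) = t" for w
    proof -
      have "cball w (p ^ 8) \<subseteq> D"
      proof
        fix y assume "y \<in> cball w (p ^ 8)"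
        then have "cmod (w - y) \<le> p ^ 8" by (simp add: dist_norm)
        then show "y \<in> D"
          using w norm_triangle_ineq2[of w y] norm_triangle_ineq3[of w y] p_bounds(3,7,8,13) p_small
          unfolding t_def diff_zero by (intro outer_annulus) linarith+
      qed
      then have "cmod (f w) \<le> 20 / p ^ 8" using p_bounds(7) by (intro L2h_pointwise_bound[OF f]) auto
      then have "cmod w * cmod (f w) \<le> t * (20 / p ^ 8)" using w t by (intro mult_mono) auto
      then show ?thesis using p_pos by (simp add: g_def norm_mult t_def)
    qed
    have circ_T: "cmod (g w) \<le> 40" if w: "cmod (w - 0) = \<delta> / 2" for w
    proof -
      have "cmod w * cmod (f w) \<le> (\<delta> / 2) * (80 / \<delta>)"
        using w p_bounds(8) L2h_bound_outer_circle[OF f, of w] by (intro mult_mono) auto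
      then show ?thesis using p_bounds(8) by (simp add: g_def norm_mult)
    qed
    obtain G h where hol_G: "G holomorphic_on ball 0 (\<delta> / 2)" and hol_h: "h holomorphic_on - cball 0 t"
      and eq: "\<And>w. \<lbrakk>t < cmod (w - 0); cmod (w - 0) < \<delta> / 2\<rbrakk> \<Longrightarrow> g w = G w + h w"
      and G: "\<And>M w. \<lbrakk>\<And>u. cmod (u - 0) = \<delta> / 2 \<Longrightarrow> cmod (g u) \<le> M; cmod (w - 0) < \<delta> / 2\<rbrakk> \<Longrightarrow>
         cmod (G w) \<le> M * (\<delta> / 2) / (\<delta> / 2 - cmod (w - 0))"
      and h: "\<And>M w. \<lbrakk>\<And>u. cmod (u - 0) = t \<Longrightarrow> cmod (g u) \<le> M; t < cmod (w - 0)\<rbrakk> \<Longrightarrow>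
         cmod (h w) \<le> M * t / (cmod (w - 0) - t)"
      by (rule holomorphic_annulus_decomposition[OF holg open_D t(1,2) sub]) blast
    have "cmod ((deriv ^^ 2) G z) \<le> fact 2 * 80 / (\<delta> / 8) ^ 2"
    proof (rule Cauchy_inequality)
      have b: "cmod y \<le> \<delta> / 4" if "cmod (z - y) \<le> \<delta> / 8" for y
        using that z norm_triangle_ineq3[of z y] p_small p_bounds(13) by linarith
      then have "cball z (\<delta> / 8) \<subseteq> ball 0 (\<delta> / 2)" using p_bounds(8) by (force simp: dist_norm)
      then have hol': "G holomorphic_on cball z (\<delta> / 8)" using hol_G holomorphic_on_subset by blast
      then show "G holomorphic_on ball z (\<delta> / 8)" by (rule holomorphic_on_subset) auto
      show "continuous_on (cball z (\<delta> / 8)) G" using hol' by (rule holomorphic_on_imp_continuous_on)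
      show "cmod (G y) \<le> 80" if y: "cmod (z - y) = \<delta> / 8" for y
      proof -
        have "cmod (G y) \<le> 40 * (\<delta> / 2) / (\<delta> / 2 - cmod (y - 0))"
          using b[of y] y p_bounds(8) circ_T by (intro G) auto
        also have "\<dots> \<le> 40 * (\<delta> / 2) / (\<delta> / 4)"
          using b[of y] y p_bounds(8) by (intro divide_left_mono mult_pos_pos) auto
        finally show ?thesis using p_bounds(8) by simp
      qed
    qed (use p_bounds(8) in auto)
    then have G2: "cmod ((deriv ^^ 2) G z) \<le> 10240 / \<delta>\<^sup>2" by (simp add: power_divide)
    have sub_h: "cball z (p\<^sup>2 / 2) \<subseteq> - cball 0 t" and b: "\<And>y. cmod (z - y) \<le> p\<^sup>2 / 2 \<Longrightarrow> p\<^sup>2 / 2 \<le> cmod y"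
    proof -
      show b: "p\<^sup>2 / 2 \<le> cmod y" if "cmod (z - y) \<le> p\<^sup>2 / 2" for y
        using that z norm_triangle_ineq2[of z y] by linarith
      show "cball z (p\<^sup>2 / 2) \<subseteq> - cball 0 t"
      proof
        fix y assume "y \<in> cball z (p\<^sup>2 / 2)"
        then have "p\<^sup>2 / 2 \<le> cmod y" using b by (simp add: dist_norm)
        then show "y \<in> - cball 0 t" using t p_bounds(13) by auto
      qed
    qed
    \<comment> \<open>\<open>h\<close> is of order \<open>p ^ 6\<close> at distance
      \<open>p^2\<close> from 0, so two derivatives leave order \<open>p^2\<close>, which is
      harmless.\<close>
    have "cmod ((deriv ^^ 2) h z) \<le> fact 2 * (1280 * p ^ 6) / (p\<^sup>2 / 2) ^ 2"
    proof (rule Cauchy_inequality)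
      have hol': "h holomorphic_on cball z (p\<^sup>2 / 2)" using hol_h sub_h holomorphic_on_subset by blast
      then show "h holomorphic_on ball z (p\<^sup>2 / 2)" by (rule holomorphic_on_subset) auto
      show "continuous_on (cball z (p\<^sup>2 / 2)) h" using hol' by (rule holomorphic_on_imp_continuous_on)
      show "cmod (h y) \<le> 1280 * p ^ 6" if y: "cmod (z - y) = p\<^sup>2 / 2" for y
      proof -
        have yb: "p\<^sup>2 / 2 \<le> cmod y" using b y by simp
        then have "cmod (h y) \<le> 80 * t / (cmod (y - 0) - t)"
          using t p_bounds(13) circ_t by (intro h) auto
        also have "\<dots> \<le> 80 * t / (p\<^sup>2 / 4)"
          using yb t p_bounds(13) by (intro divide_left_mono mult_pos_pos) auto
        also have "\<dots> = 1280 * p ^ 6" using p_pos by (simp add: t_def field_simps flip: power_add)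
        finally show ?thesis .
      qed
    qed (use p_bounds(13) in auto)
    also have "\<dots> = 10240 * p\<^sup>2" using p_pos by (simp add: power_divide field_simps flip: power_mult power_add)
    also have "\<dots> \<le> 10240" using p_bounds(1) by simp
    finally have h2: "cmod ((deriv ^^ 2) h z) \<le> 10240" .
    define S where "S = ball 0 (\<delta> / 2) - cball (0::complex) t"
    have S: "open S" "z \<in> S" unfolding S_def using z t p_small p_bounds(13) by auto
    have "(deriv ^^ 2) g z = (deriv ^^ 2) (\<lambda>w. G w + h w) z"
    proof (rule higher_deriv_transform_within_open[OF _ _ S])
      show "g holomorphic_on S" using sub by (intro holomorphic_on_subset[OF holg]) (auto simp: S_def)
      show "(\<lambda>w. G w + h w) holomorphic_on S"
        by (intro holomorphic_intros holomorphic_on_subset[OF hol_G] holomorphic_on_subset[OF hol_h]) (auto simp: S_def)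
    qed (use eq in \<open>auto simp: S_def\<close>)
    also have "\<dots> = (deriv ^^ 2) G z + (deriv ^^ 2) h z"
      by (intro higher_deriv_add[of _ S] S holomorphic_on_subset[OF hol_G] holomorphic_on_subset[OF hol_h]) (auto simp: S_def)
    finally have "cmod ((deriv ^^ 2) g z) \<le> 10240 / \<delta>\<^sup>2 + 10240"
      using norm_triangle_ineq[of "(deriv ^^ 2) G z" "(deriv ^^ 2) h z"] G2 h2 by simp
    \<comment> \<open>This uses \<open>f'(z) = 0\<close>.\<close>
    moreover have "(deriv ^^ 2) g z = z * (deriv ^^ 2) f z"
      using deriv2_times_id[OF hol open_D z(2)] van[of 1] by (simp add: g_def)
    ultimately have "p\<^sup>2 * cmod ((deriv ^^ 2) f z) \<le> K"
      by (simp add: norm_mult z K_def algebra_simps)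
    then have "(p\<^sup>2 * cmod ((deriv ^^ 2) f z))\<^sup>2 \<le> K\<^sup>2" by (intro power_mono) auto
    then show ?thesis using p_pos by (simp add: power_mult_distrib field_simps flip: power_mult)
  qed
  then have "bergman_J 2 D z \<le> K\<^sup>2 / p ^ 4" by (intro bergman_J_le) auto
  then show ?thesis using p_pos by (simp add: z_def K_def pos_le_divide_eq)
qed

text \<open>The test function is \<open>1 / (w - a)\<close> minus its value at \<open>z\<close>. The
  square of its derivative is of order \<open>p ^ -8\<close> and its squared norm at most of order
  \<open>p ^ -4\<close>, the constant dominating; 2176 = 16 * 136.\<close>

lemma outer_J1_ge:
  "1 / 2176 \<le> bergman_J 1 D (- of_real (p\<^sup>2)) * p ^ 4"
proof -
  define z :: complex where "z = - of_real (p\<^sup>2)"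
  have z: "z \<in> D" unfolding z_def by (rule outer_point)
  have "z - a = - of_real (p\<^sup>2 + p ^ 8)" by (simp add: z_def a_def)
  then have za: "cmod (z - a) = p\<^sup>2 + p ^ 8" using p_pos by (simp del: of_real_add)
  define c where "c = 1 / (z - a)"
  define f where "f = (\<lambda>w. 1 / (w - a) - c)"
  have hol: "f holomorphic_on D"
    unfolding f_def using far_from_hole' by (intro holomorphic_intros) auto
  have "(f has_field_derivative - 1 / (z - a)\<^sup>2) (at z)"
    unfolding f_def using far_from_hole'[OF z]
    by (auto intro!: derivative_eq_intros simp: power2_eq_square)
  then have d: "deriv f z = - 1 / (z - a)\<^sup>2" by (rule DERIV_imp_deriv)
  have f0: "f z = 0" by (simp add: f_def c_def)
  have c: "(cmod c)\<^sup>2 \<le> 1 / p ^ 4"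
  proof -
    have "(cmod c)\<^sup>2 = 1 / (p\<^sup>2 + p ^ 8)\<^sup>2" by (simp add: c_def norm_divide za power_divide)
    also have "\<dots> \<le> 1 / (p\<^sup>2)\<^sup>2" using p_pos
      by (intro divide_left_mono power_mono mult_pos_pos zero_less_power add_pos_pos) auto
    finally show ?thesis by (simp flip: power_mult)
  qed
  have le: "(cmod ((deriv ^^ 1) f z))\<^sup>2 / (64 * 2 / p\<^sup>2 + 4 * (2 / p ^ 4)) \<le> bergman_J 1 D z"
  proof (rule bergman_J_test[OF z hol])
    fix w assume "w \<in> D"
    have "(cmod (f w))\<^sup>2 \<le> (cmod (1 / (w - a)) + cmod c)\<^sup>2"
      unfolding f_def by (intro power_mono norm_triangle_ineq4) auto
    also have "\<dots> \<le> 2 * (cmod (1 / (w - a)))\<^sup>2 + 2 * (cmod c)\<^sup>2"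
      using sum_squares_bound[of "cmod (1 / (w - a))" "cmod c"] by (simp add: power2_sum)
    also have "\<dots> \<le> 2 * (1 / (cmod (w - a))\<^sup>2) + 2 / p ^ 4"
      using c by (simp add: norm_divide power_divide)
    finally show "(cmod (f w))\<^sup>2 \<le> 2 * (1 / (cmod (w - a))\<^sup>2) + 2 / p ^ 4" .
  qed (use p_pos f0 in auto)
  have "1 / (16 * p ^ 8) \<le> (cmod (deriv f z))\<^sup>2"
  proof -
    have "(p\<^sup>2 + p ^ 8) ^ 4 \<le> (2 * p\<^sup>2) ^ 4"
      using p_bounds(3,7,13) by (intro power_mono; linarith)
    then have "1 / (2 * p\<^sup>2) ^ 4 \<le> 1 / (p\<^sup>2 + p ^ 8) ^ 4"
      using p_pos by (intro divide_left_mono) (auto intro!: mult_pos_pos zero_less_power add_pos_pos)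
    also have "\<dots> = (cmod (deriv f z))\<^sup>2"
      by (simp add: d norm_divide norm_power za power_divide flip: power_mult)
    finally show ?thesis by (simp add: power_mult_distrib flip: power_mult)
  qed
  moreover have "64 * 2 / p\<^sup>2 + 4 * (2 / p ^ 4) \<le> 136 / p ^ 4"
  proof -
    have "128 * p\<^sup>2 \<le> 128" using p_bounds(1) by linarith
    then show ?thesis using p_pos by (simp add: divide_simps power2_eq_square power4_eq_xxxx)
  qed
  ultimately have "(1 / (16 * p ^ 8)) / (136 / p ^ 4) \<le> (cmod (deriv f z))\<^sup>2 / (64 * 2 / p\<^sup>2 + 4 * (2 / p ^ 4))"
    using p_pos by (intro frac_le) (auto intro!: add_pos_pos)
  also have "\<dots> \<le> bergman_J 1 D z" using le by simp
  also have "(1 / (16 * p ^ 8)) / (136 / p ^ 4) = 1 / 2176 / p ^ 4"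
    using p_pos by (simp add: field_simps flip: power_add)
  finally show ?thesis using p_pos by (simp add: z_def pos_divide_le_eq)
qed

text \<open>Multiplying each of the three quantities by \<open>p ^ 4\<close> leaves the quotient
  unchanged. All the smallness comes from the bound for \<open>J 0\<close>.\<close>

lemma outer_curvature_ge:
  assumes N: "0 < N" "4 ^ Suc N * p ^ 6 \<le> 1"
  shows "bergman_curvature D (- of_real (p\<^sup>2)) \<ge>
    2 - 51200 * (1 / N + p ^ 4 / \<delta>\<^sup>2) * (10240 * (1 + 1 / \<delta>\<^sup>2))\<^sup>2 * 2176\<^sup>2"
proof -
  define J where "J = (\<lambda>j. bergman_J j D (- of_real (p\<^sup>2)))"
  define A where "A = 51200 * (1 / N + p ^ 4 / \<delta>\<^sup>2)"
  define B where "B = (10240 * (1 + 1 / \<delta>\<^sup>2))\<^sup>2"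
  have nn: "0 \<le> J j" for j unfolding J_def by (intro bergman_J_nonneg open_D outer_point)
  have pos: "0 < p ^ 4" using p_pos by simp
  have J0: "J 0 * p ^ 4 \<le> A" unfolding J_def A_def by (rule outer_J0_le[OF N])
  have J2: "J 2 * p ^ 4 \<le> B" unfolding J_def B_def by (rule outer_J2_le)
  have J1: "1 / 2176 \<le> J 1 * p ^ 4" unfolding J_def by (rule outer_J1_ge)
  have "J 0 * J 2 / (J 1)\<^sup>2 = ((J 0 * p ^ 4) * (J 2 * p ^ 4)) / (J 1 * p ^ 4)\<^sup>2"
    using pos by (simp add: power2_eq_square)
  also have "\<dots> \<le> (A * B) / (1 / 2176)\<^sup>2"
    using J0 J1 J2 nn pos by (intro frac_le mult_mono power_mono) (auto simp: A_def B_def)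
  finally show ?thesis by (simp add: bergman_curvature_def J_def A_def B_def power_divide)
qed

end

subsection \<open>A point with very negative curvature\<close>

context punctured_domain
begin

lemma inner_point:
  shows "a + of_real (p ^ 10) \<in> D" "cmod (a + of_real (p ^ 10)) = p ^ 8 + p ^ 10"
proof -
  have "a + of_real (p ^ 10) = of_real (p ^ 8 + p ^ 10)" by (simp add: a_def)
  then show *: "cmod (a + of_real (p ^ 10)) = p ^ 8 + p ^ 10"
    using p_pos by (simp del: of_real_add)
  show "a + of_real (p ^ 10) \<in> D"
  proof (rule annulus)
    show "a + of_real (p ^ 10) \<notin> cball a (p ^ 16)"
    proof -
      have "p ^ 16 < p ^ 10" using p_bounds(5,12) by linarith
      then show ?thesis using p_pos by (auto simp: dist_norm norm_power)
    qed
  qed (use * s_le p_bounds p_small in linarith)+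
qed

text \<open>The test function \<open>1 / (w - a)\<close> has squared value \<open>p ^ -20\<close> at
  the point and squared norm at most \<open>64 / p^2\<close>.\<close>

lemma inner_J0_ge: "1 / (64 * p ^ 18) \<le> bergman_J 0 D (a + of_real (p ^ 10))"
proof -
  define z where "z = a + of_real (p ^ 10)"
  have z: "z \<in> D" unfolding z_def by (rule inner_point)
  have za: "cmod (z - a) = p ^ 10" using p_pos by (simp add: z_def norm_power)
  have "(\<lambda>w. 1 / (w - a)) holomorphic_on D"
    using far_from_hole' by (intro holomorphic_intros) auto
  then have "(cmod (1 / (z - a)))\<^sup>2 / (64 * 1 / p\<^sup>2 + 4 * e) \<le> bergman_J 0 D z" if "0 < e" for e
    using bergman_J_test[OF z, of "\<lambda>w. 1 / (w - a)" 1 e 0] that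
    by (auto simp: norm_divide power_divide)
  then have le: "(1 / p ^ 20) / (64 / p\<^sup>2 + 4 * e) \<le> bergman_J 0 D z" if "0 < e" for e
    using that by (simp add: norm_divide za power_divide flip: power_mult)
  txt \<open>The limit is needed only because \<open>bergman_J_test\<close> asks for a positive constant term.\<close>
  have "((\<lambda>e. (1 / p ^ 20) / (64 / p\<^sup>2 + 4 * e)) \<longlongrightarrow> (1 / p ^ 20) / (64 / p\<^sup>2 + 4 * 0)) (at_right 0)"
    using p_pos by (intro tendsto_intros) auto
  moreover have "\<forall>\<^sub>F e in at_right 0. (1 / p ^ 20) / (64 / p\<^sup>2 + 4 * e) \<le> bergman_J 0 D z"
    using le by (auto simp: eventually_at_right_field intro: exI[of _ 1])
  ultimately have "(1 / p ^ 20) / (64 / p\<^sup>2 + 4 * 0) \<le> bergman_J 0 D z"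
    by (intro tendsto_upperbound) auto
  moreover have "(1 / p ^ 20) / (64 / p\<^sup>2 + 4 * 0) = 1 / (64 * p ^ 18)"
    using p_pos by (simp add: field_simps flip: power_add)
  ultimately show ?thesis by (simp add: z_def)
qed

text \<open>The square of \<open>1 / (w - a) - 1 / (z - a)\<close> has a double zero at
  \<open>z\<close> and second derivative \<open>2 / (z - a) ^ 4\<close> there.\<close>

lemma inner_J2_ge: "1 / (136 * p ^ 40) \<le> bergman_J 2 D (a + of_real (p ^ 10))"
proof -
  define z where "z = a + of_real (p ^ 10)"
  have z: "z \<in> D" unfolding z_def by (rule inner_point)
  have za: "z - a = of_real (p ^ 10)" by (simp add: z_def)
  have zna: "z \<noteq> a" using far_from_hole'[OF z] .
  define v where "v = (\<lambda>w. 1 / (w - a))"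
  define c where "c = v z"
  define f where "f = (\<lambda>w. (v w - c)\<^sup>2)"
  define f' where "f' = (\<lambda>w. - 2 * (v w - c) * (v w)\<^sup>2)"
  have v_der: "(v has_field_derivative - (v w)\<^sup>2) (at w)" if "w \<noteq> a" for w
    unfolding v_def using that by (auto intro!: derivative_eq_intros simp: power2_eq_square)
  have hol: "f holomorphic_on D"
    unfolding f_def v_def using far_from_hole' by (intro holomorphic_intros) auto
  have der: "deriv f w = f' w" if "w \<in> D" for w
  proof (rule DERIV_imp_deriv)
    show "(f has_field_derivative f' w) (at w)"
      unfolding f_def f'_def using far_from_hole'[OF that]
      by (auto intro!: derivative_eq_intros v_der simp: algebra_simps)
  qed
  have f'_der: "(f' has_field_derivative 2 / (z - a) ^ 4) (at z)"
    unfolding f'_def using zna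
    by (auto intro!: derivative_eq_intros v_der simp: c_def)
      (simp add: v_def power_divide power_one_over flip: power_add power_mult)
  have "(deriv ^^ 2) f z = deriv (deriv f) z" by (simp add: numeral_2_eq_2)
  also have "\<dots> = 2 / (z - a) ^ 4"
  proof (rule DERIV_imp_deriv)
    show "(deriv f has_field_derivative 2 / (z - a) ^ 4) (at z)"
      by (rule has_field_derivative_transform_within_open[OF f'_der open_D z]) (simp add: der)
  qed
  finally have "cmod ((deriv ^^ 2) f z) = 2 / p ^ 40"
    by (simp add: za norm_divide norm_power flip: power_mult)
  then have f2: "(cmod ((deriv ^^ 2) f z))\<^sup>2 = 4 / p ^ 80" by (simp add: power_divide flip: power_mult)
  have "(deriv ^^ i) f z = 0" if "i < 2" for i
    using that der[OF z] by (auto simp: less_2_cases_iff f'_def c_def f_def)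
  then have le: "(cmod ((deriv ^^ 2) f z))\<^sup>2 / (64 * (8 / p ^ 32) / p\<^sup>2 + 4 * (8 / p ^ 40)) \<le> bergman_J 2 D z"
  proof (intro bergman_J_test[OF z hol])
    fix w assume w: "w \<in> D"
    define X where "X = (1 / cmod (w - a))\<^sup>2"
    have c: "(cmod c)\<^sup>2 = 1 / p ^ 20"
      by (simp add: c_def v_def za norm_divide norm_power power_divide flip: power_mult)
    have "cmod (f w) = (cmod (1 / (w - a) - c))\<^sup>2" by (simp add: f_def v_def norm_power)
    also have "\<dots> \<le> (cmod (1 / (w - a)) + cmod c)\<^sup>2"
      by (intro power_mono norm_triangle_ineq4) auto
    also have "\<dots> \<le> 2 * (cmod (1 / (w - a)))\<^sup>2 + 2 * (cmod c)\<^sup>2"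
      using sum_squares_bound[of "cmod (1 / (w - a))" "cmod c"] by (simp add: power2_sum)
    also have "\<dots> = 2 * X + 2 / p ^ 20" by (simp add: X_def norm_divide c)
    finally have "(cmod (f w))\<^sup>2 \<le> (2 * X + 2 / p ^ 20)\<^sup>2" by (intro power_mono) auto
    also have "\<dots> \<le> 8 * X\<^sup>2 + 8 * (1 / p ^ 20)\<^sup>2"
    proof -
      have "(2 * X + 2 * Y)\<^sup>2 \<le> 8 * X\<^sup>2 + 8 * Y\<^sup>2" for Y
        using sum_squares_bound[of X Y] by (simp add: power2_sum power_mult_distrib)
      from this[of "1 / p ^ 20"] show ?thesis by simp
    qed
    also have "(1 / p ^ 20)\<^sup>2 = 1 / p ^ 40" by (simp add: power_divide flip: power_mult)
    \<comment> \<open>The hole bounds one factor \<open>X\<close>, which reduces the fourth-order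
      singularity to the form \<open>bergman_J_test\<close> accepts. The resulting term is smaller
      than the constant one by a factor of order \<open>p ^ 6\<close>.\<close>
    also have "X\<^sup>2 \<le> (1 / p ^ 32) * X"
    proof -
      have "X \<le> (1 / p ^ 16)\<^sup>2"
        unfolding X_def using far_from_hole[OF w] far_from_hole'[OF w] p_bounds(11) p_pos
        by (intro power_mono divide_left_mono) auto
      then have "X * X \<le> (1 / p ^ 16)\<^sup>2 * X" by (intro mult_right_mono) (auto simp: X_def)
      then show ?thesis by (simp add: power_divide power2_eq_square flip: power_add)
    qed
    finally show "(cmod (f w))\<^sup>2 \<le> 8 / p ^ 32 * (1 / (cmod (w - a))\<^sup>2) + 8 / p ^ 40"
      by (simp add: X_def power_divide)
  qed (use p_pos in auto)
  have "64 * (8 / p ^ 32) / p\<^sup>2 + 4 * (8 / p ^ 40) \<le> 544 / p ^ 40"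
  proof -
    have "64 * (8 / p ^ 32) / p\<^sup>2 = 512 * p ^ 6 / p ^ 40"
      using p_pos by (simp add: field_simps flip: power_add)
    also have "\<dots> \<le> 512 / p ^ 40" using p_bounds(10) p_pos by (intro divide_right_mono) auto
    finally show ?thesis by (simp add: add_divide_distrib[symmetric])
  qed
  moreover have "0 < 64 * (8 / p ^ 32) / p\<^sup>2 + 4 * (8 / p ^ 40)"
    using p_pos by (intro add_pos_pos) auto
  ultimately have "(4 / p ^ 80) / (544 / p ^ 40) \<le> (4 / p ^ 80) / (64 * (8 / p ^ 32) / p\<^sup>2 + 4 * (8 / p ^ 40))"
    using p_pos by (intro frac_le) auto
  also have "\<dots> \<le> bergman_J 2 D z" using le by (simp add: f2)
  also have "(4 / p ^ 80) / (544 / p ^ 40) = 1 / (136 * p ^ 40)"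
    using p_pos by (simp add: field_simps flip: power_add)
  finally show ?thesis by (simp add: z_def)
qed

text \<open>With the influence of the holes near 0 split off as \<open>h0\<close>, the product rule
  and \<open>f z = 0\<close> give \<open>(z - a) * f'(z)\<close> up to small terms as the derivative
  of \<open>(w - a) * (f - h0)\<close>. That derivative is of order \<open>p ^ -4\<close>, and
  division by \<open>|z - a| = p ^ 10\<close> gives \<open>p ^ -14\<close>.\<close>

lemma inner_J1_le:
  assumes N: "0 < N" "s * 4 ^ N \<le> p ^ 8 / 4" "102400 \<le> N * p ^ 32"
  shows "bergman_J 1 D (a + of_real (p ^ 10)) \<le> (2000 / p ^ 14)\<^sup>2"
proof -
  define z where "z = a + of_real (p ^ 10)"
  have zD: "z \<in> D" and nz: "cmod z = p ^ 8 + p ^ 10" unfolding z_def by (rule inner_point)+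
  have za: "z - a = of_real (p ^ 10)" by (simp add: z_def)
  have nza: "cmod (z - a) = p ^ 10" using p_pos by (simp add: za norm_power)
  define x r where "x = p ^ 8" and "r = p ^ 16"
  have pb: "0 < x" "0 < r" "r \<le> x / 65536" "r \<le> p ^ 10 / 4096" "p ^ 10 \<le> x / 16"
    "x \<le> \<delta> / 32768" "x \<le> 1 / 65536" "s \<le> x / 4" "cmod a = x" "0 < \<delta>" "0 < p ^ 10"
    using p_bounds p_small s_le norm_a unfolding x_def r_def by linarith+
  have "cmod (deriv f z) \<le> 2000 / p ^ 14"
    if f: "f \<in> L2h D" "L2_norm_on D f \<le> 1" and f0: "f z = 0" for f
  proof -
    have hol: "f holomorphic_on D" using f by (simp add: L2h_def)

    \<comment> \<open>Splitting off the holes near 0\<close>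
    have sN: "s * 4 ^ N \<le> x / 4" using N(2) by (simp add: x_def)
    have "{w. s < cmod (w - 0) \<and> cmod (w - 0) < s * 4 ^ N} \<subseteq> D"
    proof
      fix w assume "w \<in> {w. s < cmod (w - 0) \<and> cmod (w - 0) < s * 4 ^ N}"
      then have "s < cmod w" "cmod w < s * 4 ^ N" by auto
      then show "w \<in> D" using sN pb(1) unfolding x_def by (intro inner_annulus) linarith+
    qed
    then obtain t where t: "s < t" "t < s * 4 ^ N"
      "\<And>w. cmod (w - 0) = t \<Longrightarrow> (t * cmod (f w))\<^sup>2 * N \<le> 6400"
      using L2h_bound_on_annuli[OF f N(1) s_pos, of 0] by blast
    have t0: "0 < t" "t < x / 4" using t(1,2) s_pos sN by linarith+
    \<comment> \<open>Since 102400 = 16 * 6400, the condition on \<open>N\<close> turns the annulus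
      bound into \<open>t * |f| \<le> x^2 / 4\<close>. This makes \<open>h0\<close> at most
      \<open>x\<close> outside the disc of radius \<open>x / 2\<close>.\<close>
    have circ: "cmod (f w) \<le> x\<^sup>2 / 4 / t" if "cmod (w - 0) = t" for w
    proof -
      have "x ^ 4 = p ^ 32" by (simp add: x_def flip: power_mult)
      then have "102400 * (t * cmod (f w))\<^sup>2 \<le> (N * x ^ 4) * (t * cmod (f w))\<^sup>2"
        using N(3) by (intro mult_right_mono) auto
      also have "\<dots> = x ^ 4 * ((t * cmod (f w))\<^sup>2 * N)" by simp
      also have "\<dots> \<le> x ^ 4 * 6400" using t(3)[OF that] by (intro mult_left_mono) auto
      also have "\<dots> = 102400 * (x\<^sup>2 / 4)\<^sup>2" by (simp add: power_divide flip: power_mult)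
      finally have "(t * cmod (f w))\<^sup>2 \<le> (x\<^sup>2 / 4)\<^sup>2" by simp
      then have "t * cmod (f w) \<le> x\<^sup>2 / 4" by (rule power2_le_imp_le) simp
      then show ?thesis using t0 by (subst pos_le_divide_eq) (simp_all add: mult.commute)
    qed
    have tx: "t < x / 2" using t0 pb(1) by linarith
    have sub0: "{w. t \<le> cmod (w - 0) \<and> cmod (w - 0) \<le> x / 2} \<subseteq> D"
      using t(1) by (auto intro!: inner_annulus simp: x_def)
    obtain G0 h0 where hol_G0: "G0 holomorphic_on ball 0 (x / 2)" and hol_h0: "h0 holomorphic_on - cball 0 t"
      and eq0: "\<And>w. \<lbrakk>t < cmod (w - 0); cmod (w - 0) < x / 2\<rbrakk> \<Longrightarrow> f w = G0 w + h0 w"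
      and h0: "\<And>M w. \<lbrakk>\<And>u. cmod (u - 0) = t \<Longrightarrow> cmod (f u) \<le> M; t < cmod (w - 0)\<rbrakk> \<Longrightarrow>
         cmod (h0 w) \<le> M * t / (cmod (w - 0) - t)"
      by (rule holomorphic_annulus_decomposition[OF hol open_D t0(1) tx sub0]) blast
    have h0x: "cmod (h0 w) \<le> x" if w: "x / 2 \<le> cmod w" for w
    proof -
      have wt: "t < cmod (w - 0)" "x / 4 \<le> cmod (w - 0) - t"
        using w t0 pb(1) unfolding diff_zero by linarith+
      have "cmod (h0 w) \<le> (x\<^sup>2 / 4 / t) * t / (cmod (w - 0) - t)"
        using circ wt by (intro h0) auto
      also have "\<dots> \<le> (x\<^sup>2 / 4 / t) * t / (x / 4)"
        using wt t0 pb(1) by (intro divide_left_mono mult_pos_pos) auto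
      also have "\<dots> = x" using t0 pb(1) by (simp add: power2_eq_square)
      finally show ?thesis .
    qed
    txt \<open>Subtracting \<open>h0\<close>, which is small since \<open>s\<close> is tiny, removes all the holes near 0 at once.\<close>
    define F where "F = (\<lambda>w. if w \<in> ball 0 (x / 2) then G0 w else f w - h0 w)"
    define V where "V = D - cball 0 t"
    have FV: "F w = f w - h0 w" if "w \<in> V" for w
      using that eq0[of w] by (auto simp: F_def V_def)
    have V: "open V" using open_D by (auto simp: V_def)
    \<comment> \<open>The two definitions of \<open>F\<close> agree where
      \<open>t < |w| < x / 2\<close>, so they glue. On \<open>U\<close> the only hole left is the
      one about \<open>a\<close>.\<close>
    have "F holomorphic_on V"
      by (rule holomorphic_transform[of "\<lambda>w. f w - h0 w"])
        (auto intro!: holomorphic_on_diff holomorphic_on_subset[OF hol] holomorphic_on_subset[OF hol_h0] simp: FV, auto simp: V_def)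
    moreover have "F holomorphic_on ball 0 (x / 2)"
      by (rule holomorphic_transform[OF hol_G0]) (auto simp: F_def)
    ultimately have "F holomorphic_on (V \<union> ball 0 (x / 2))"
      using V by (intro holomorphic_on_Un) auto
    moreover define U where "U = ball 0 \<delta> - cball a r"
    have "U \<subseteq> V \<union> ball 0 (x / 2)"
    proof
      fix w assume w: "w \<in> U"
      show "w \<in> V \<union> ball 0 (x / 2)"
      proof (cases "cmod w < x / 2")
        case False
        then have "s < cmod w" "t < cmod w" using pb(1,8) t0 by linarith+
        then show ?thesis using w annulus[of w] by (auto simp: U_def V_def r_def)
      qed auto
    qed
    ultimately have hol_F: "F holomorphic_on U" using holomorphic_on_subset by blast
    have F_le: "cmod (F w) \<le> cmod (f w) + x" if "x / 2 \<le> cmod w" for w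
      using that norm_triangle_ineq4[of "f w" "h0 w"] h0x[OF that] by (auto simp: F_def)
    \<comment> \<open>The factor turns the simple pole part \<open>1 / (w - a)\<close>, which the
      hole controls only logarithmically, into a constant.\<close>
    define g where "g = (\<lambda>w. (w - a) * F w)"
    have hol_g: "g holomorphic_on U" unfolding g_def by (intro holomorphic_intros hol_F)
    have U: "open U" by (auto simp: U_def)

    \<comment> \<open>Bounds on the outer circle and on the circle around the hole\<close>
    have circ_T: "cmod (g w) \<le> 41" if w: "cmod (w - a) = \<delta> / 2" for w
    proof -
      have nw: "\<bar>cmod w - \<delta> / 2\<bar> \<le> x"
        using w norm_triangle_ineq3[of w "w - a"] pb(9) by simp
      have "cball w (\<delta>/4) \<subseteq> D"
      proof
        fix y assume "y \<in> cball w (\<delta>/4)"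
        then have "cmod (w - y) \<le> \<delta>/4" by (simp add: dist_norm)
        then show "y \<in> D"
          using nw norm_triangle_ineq3[of w y] pb
          by (intro outer_annulus) (unfold x_def[symmetric], linarith+)
      qed
      then have "cmod (f w) \<le> 20 / (\<delta>/4)" using pb(10) by (intro L2h_pointwise_bound[OF f]) auto
      moreover have "x / 2 \<le> cmod w" using nw pb(1,6) by linarith
      ultimately have "cmod (F w) \<le> 80 / \<delta> + 1" using F_le[of w] pb(7) by simp
      then have "cmod (w - a) * cmod (F w) \<le> (\<delta> / 2) * (80 / \<delta> + 1)"
        using w pb(10) by (intro mult_mono) auto
      also have "\<dots> \<le> 41" using pb(10) \<delta>_le by (simp add: field_simps)
      finally show ?thesis by (simp add: g_def norm_mult)
    qed
    have circ_r: "cmod (g w) \<le> 81" if w: "cmod (w - a) = 2 * r" for w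
    proof -
      have nw: "\<bar>cmod w - x\<bar> \<le> 2 * r"
        using w norm_triangle_ineq3[of w a] pb(9) by simp
      have "cball w (r/2) \<subseteq> D"
      proof
        fix y assume "y \<in> cball w (r/2)"
        then have y: "cmod (w - y) \<le> r/2" by (simp add: dist_norm)
        show "y \<in> D"
        proof (rule annulus)
          show "s < cmod y" "cmod y < \<delta>" 
            using nw norm_triangle_ineq3[of w y] pb y by linarith+
          have "r < cmod (y - a)"
            using w y norm_triangle_ineq4[of "w - a" "w - y"] norm_triangle_ineq[of "w - y" "y - a"] pb(2) by simp
          then show "y \<notin> cball a (p ^ 16)" by (simp add: dist_norm norm_minus_commute r_def)
        qed
      qed
      then have "cmod (f w) \<le> 20 / (r/2)" using pb(2) by (intro L2h_pointwise_bound[OF f]) auto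
      moreover have "x / 2 \<le> cmod w" using nw pb(1,3) by linarith
      ultimately have "cmod (F w) \<le> 40 / r + 1" using F_le[of w] pb(7) by simp
      then have "cmod (w - a) * cmod (F w) \<le> (2 * r) * (40 / r + 1)"
        using w pb(2) by (intro mult_mono) auto
      also have "\<dots> = 80 + 2 * r" using pb(2) by (simp add: field_simps)
      also have "\<dots> \<le> 81" using pb(3,7) by linarith
      finally show ?thesis by (simp add: g_def norm_mult)
    qed
    have rT: "0 < 2 * r" "2 * r < \<delta> / 2" using pb by linarith+
    have sub: "{w. 2 * r \<le> cmod (w - a) \<and> cmod (w - a) \<le> \<delta> / 2} \<subseteq> U"
    proof
      fix w assume "w \<in> {w. 2 * r \<le> cmod (w - a) \<and> cmod (w - a) \<le> \<delta> / 2}"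
      then have w: "2 * r \<le> cmod (w - a)" "cmod (w - a) \<le> \<delta> / 2" by auto
      then have "cmod w < \<delta>" "r < cmod (w - a)"
        using norm_triangle_ineq2[of w a] pb by linarith+
      then show "w \<in> U" by (simp add: U_def dist_norm norm_minus_commute)
    qed
    obtain G h where hol_G: "G holomorphic_on ball a (\<delta> / 2)" and hol_h: "h holomorphic_on - cball a (2 * r)"
      and eq: "\<And>w. \<lbrakk>2 * r < cmod (w - a); cmod (w - a) < \<delta> / 2\<rbrakk> \<Longrightarrow> g w = G w + h w"
      and G: "\<And>M w. \<lbrakk>\<And>u. cmod (u - a) = \<delta> / 2 \<Longrightarrow> cmod (g u) \<le> M; cmod (w - a) < \<delta> / 2\<rbrakk> \<Longrightarrow>
         cmod (G w) \<le> M * (\<delta> / 2) / (\<delta> / 2 - cmod (w - a))"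
      and h: "\<And>M w. \<lbrakk>\<And>u. cmod (u - a) = 2 * r \<Longrightarrow> cmod (g u) \<le> M; 2 * r < cmod (w - a)\<rbrakk> \<Longrightarrow>
         cmod (h w) \<le> M * (2 * r) / (cmod (w - a) - 2 * r)"
      by (rule holomorphic_annulus_decomposition[OF hol_g U rT sub]) blast

    \<comment> \<open>Derivative bounds at the point\<close>
    have G1: "cmod (deriv G z) \<le> 656 / \<delta>"
    proof -
      have b: "cmod (y - a) \<le> \<delta> / 4" if "cmod (z - y) \<le> \<delta> / 8" for y
        using that nza norm_triangle_ineq4[of "z - a" "z - y"] pb by simp
      have "cball z (\<delta> / 8) \<subseteq> ball a (\<delta> / 2)"
        using b pb(10) by (force simp: dist_norm norm_minus_commute)
      then have hol': "G holomorphic_on cball z (\<delta> / 8)" using hol_G holomorphic_on_subset by blast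
      have "cmod ((deriv ^^ 1) G z) \<le> fact 1 * 82 / (\<delta> / 8) ^ 1"
      proof (rule Cauchy_inequality)
        show "G holomorphic_on ball z (\<delta> / 8)" by (rule holomorphic_on_subset[OF hol']) auto
        show "continuous_on (cball z (\<delta> / 8)) G" using hol' by (rule holomorphic_on_imp_continuous_on)
        show "cmod (G y) \<le> 82" if y: "cmod (z - y) = \<delta> / 8" for y
        proof -
          have "cmod (G y) \<le> 41 * (\<delta> / 2) / (\<delta> / 2 - cmod (y - a))"
            using b[of y] y pb(10) circ_T by (intro G) auto
          also have "\<dots> \<le> 41 * (\<delta> / 2) / (\<delta> / 4)"
            using b[of y] y pb(10) by (intro divide_left_mono mult_pos_pos) auto
          finally show ?thesis using pb(10) by simp
        qed
      qed (use pb(10) in auto)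
      then show ?thesis by simp
    qed
    have h1: "cmod (deriv h z) \<le> 1296 / p ^ 4"
    proof -
      define \<rho> where "\<rho> = p ^ 10"
      have \<rho>: "0 < \<rho>" "r \<le> \<rho> / 4096" using pb by (auto simp: \<rho>_def)
      have b: "\<rho> / 2 \<le> cmod (y - a)" if "cmod (z - y) \<le> \<rho> / 2" for y
        using that nza norm_triangle_ineq[of "z - y" "y - a"] by (simp add: \<rho>_def)
      have "cball z (\<rho> / 2) \<subseteq> - cball a (2 * r)"
        using b \<rho> by (force simp: dist_norm norm_minus_commute)
      then have hol': "h holomorphic_on cball z (\<rho> / 2)" using hol_h holomorphic_on_subset by blast
      \<comment> \<open>What remains of the hole has size \<open>r / \<rho>\<close> at distance
        \<open>\<rho>\<close>. One derivative gives \<open>r / \<rho>^2 = p ^ 16 / p ^ 20\<close>,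
        which fixes the order \<open>p ^ -4\<close>.\<close>
      have "cmod ((deriv ^^ 1) h z) \<le> fact 1 * (648 * r / \<rho>) / (\<rho> / 2) ^ 1"
      proof (rule Cauchy_inequality)
        show "h holomorphic_on ball z (\<rho> / 2)" by (rule holomorphic_on_subset[OF hol']) auto
        show "continuous_on (cball z (\<rho> / 2)) h" using hol' by (rule holomorphic_on_imp_continuous_on)
        show "cmod (h y) \<le> 648 * r / \<rho>" if y: "cmod (z - y) = \<rho> / 2" for y
        proof -
          have yb: "2 * r < cmod (y - a)" "\<rho> / 4 \<le> cmod (y - a) - 2 * r"
            using b[of y] y \<rho> pb(2) by linarith+
          then have "cmod (h y) \<le> 81 * (2 * r) / (cmod (y - a) - 2 * r)"
            using circ_r by (intro h) auto
          also have "\<dots> \<le> 81 * (2 * r) / (\<rho> / 4)"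
            using yb \<rho> pb(2) by (intro divide_left_mono mult_pos_pos) auto
          finally show ?thesis by simp
        qed
      qed (use \<rho> in auto)
      also have "\<dots> = 1296 / p ^ 4"
        using p_pos by (simp add: r_def \<rho>_def field_simps flip: power_add)
      finally show ?thesis by simp
    qed
    have h01: "cmod (deriv h0 z) \<le> 2"
    proof -
      have b: "x / 2 \<le> cmod y" if "cmod (z - y) \<le> x / 2" for y
        using that nz norm_triangle_ineq2[of z y] pb(11) unfolding x_def by linarith
      have "cball z (x / 2) \<subseteq> - cball 0 t"
        using b t0 pb(1) by (force simp: dist_norm)
      then have hol': "h0 holomorphic_on cball z (x / 2)" using hol_h0 holomorphic_on_subset by blast
      have "cmod ((deriv ^^ 1) h0 z) \<le> fact 1 * x / (x / 2) ^ 1"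
      proof (rule Cauchy_inequality)
        show "h0 holomorphic_on ball z (x / 2)" by (rule holomorphic_on_subset[OF hol']) auto
        show "continuous_on (cball z (x / 2)) h0" using hol' by (rule holomorphic_on_imp_continuous_on)
      qed (use pb(1) b h0x in auto)
      then show ?thesis using pb(1) by simp
    qed
    have "t < cmod z" using nz t0(2) pb(1,11) unfolding x_def by linarith
    then have zV: "z \<in> V" using zD by (simp add: V_def)
    have zb: "2 * r < cmod (z - a)" "cmod (z - a) < \<delta> / 2" using nza pb by linarith+
    have "G field_differentiable at z" "h field_differentiable at z" "h0 field_differentiable at z"
      "f field_differentiable at z"
      using holomorphic_on_imp_differentiable_at[OF hol_G] holomorphic_on_imp_differentiable_at[OF hol_h]
        holomorphic_on_imp_differentiable_at[OF hol_h0] holomorphic_on_imp_differentiable_at[OF hol]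
        zb zV zD open_D by (auto simp: dist_norm norm_minus_commute[of a z] V_def open_Compl)
    then have dG: "(G has_field_derivative deriv G z) (at z)" and dh: "(h has_field_derivative deriv h z) (at z)"
      and dh0: "(h0 has_field_derivative deriv h0 z) (at z)" and df: "(f has_field_derivative deriv f z) (at z)"
      by (simp_all add: field_differentiable_derivI)
    define S where "S = V \<inter> (ball a (\<delta> / 2) - cball a (2 * r))"
    have S: "open S" "z \<in> S" using V zV zb by (auto simp: S_def dist_norm norm_minus_commute)
    \<comment> \<open>Differentiating \<open>g\<close> at \<open>z\<close> in two ways, by the
      product rule and through the splitting, isolates \<open>(z - a) * f'(z)\<close>.\<close>
    have "((\<lambda>w. (w - a) * (f w - h0 w)) has_field_derivative
        (z - a) * (deriv f z - deriv h0 z) + (f z - h0 z)) (at z)"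
      by (rule derivative_eq_intros df dh0 refl)+ (simp add: algebra_simps)
    moreover have "((\<lambda>w. (w - a) * (f w - h0 w)) has_field_derivative (deriv G z + deriv h z)) (at z)"
    proof (rule has_field_derivative_transform_within_open[OF DERIV_add[OF dG dh] S])
      fix w assume "w \<in> S"
      then show "G w + h w = (w - a) * (f w - h0 w)"
        using eq[of w] FV[of w] by (auto simp: S_def g_def dist_norm norm_minus_commute)
    qed
    ultimately have "(z - a) * (deriv f z - deriv h0 z) + (f z - h0 z) = deriv G z + deriv h z"
      by (rule DERIV_unique)
    then have "(z - a) * deriv f z = deriv G z + deriv h z + h0 z + (z - a) * deriv h0 z"
      using f0 by (simp add: algebra_simps)
    then have "p ^ 10 * cmod (deriv f z) = cmod (deriv G z + deriv h z + h0 z + (z - a) * deriv h0 z)"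
      using nza by (metis norm_mult)
    also have "\<dots> \<le> cmod (deriv G z) + cmod (deriv h z) + cmod (h0 z) + cmod (z - a) * cmod (deriv h0 z)"
      by (intro order_trans[OF norm_triangle_ineq] add_mono) (auto simp: norm_mult norm_triangle_ineq)
    also have "\<dots> \<le> 656 / \<delta> + 1296 / p ^ 4 + x + p ^ 10 * 2"
      using G1 h1 h01 h0x[of z] nz nza pb unfolding x_def by (intro add_mono mult_mono) auto
    \<comment> \<open>656 + 1296 = 1952; the remaining 48 absorbs the contributions of
      \<open>h0\<close>.\<close>
    also have "\<dots> \<le> 2000 / p ^ 4"
    proof -
      have "p ^ 4 = p\<^sup>2 * p\<^sup>2" by (simp flip: power_add)
      also have "\<dots> \<le> (1/16) * p\<^sup>2" using p_bounds(1) by (intro mult_right_mono) auto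
      finally have p4: "p ^ 4 \<le> \<delta>" "p ^ 4 \<le> 1" using p_small p_bounds(1,13) by linarith+
      have "656 / \<delta> \<le> 656 / p ^ 4" using p4 p_pos pb(10) by (intro divide_left_mono) auto
      moreover have "1 \<le> 1 / p ^ 4" using p4 p_pos by simp
      moreover have "656 / p ^ 4 + 1296 / p ^ 4 + 48 * (1 / p ^ 4) = 2000 / p ^ 4"
        by (simp add: add_divide_distrib[symmetric])
      ultimately show ?thesis using pb(5,7) by linarith
    qed
    finally have "cmod (deriv f z) \<le> (2000 / p ^ 4) / p ^ 10"
      using pb(11) by (metis pos_le_divide_eq mult.commute)
    also have "\<dots> = 2000 / p ^ 14" by (simp add: divide_divide_eq_left flip: power_add)
    finally show ?thesis .
  qed
  then show ?thesis unfolding z_def[symmetric]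
    by (intro bergman_J_le power_mono) auto
qed

text \<open>\<open>J 0 * J 2\<close> is at least of order \<open>p ^ -58\<close> and
  \<open>(J 1)^2\<close> at most of order \<open>p ^ -56\<close>, so \<open>p ^ -2\<close> survives;
  8704 = 64 * 136.\<close>

lemma inner_curvature_le:
  assumes N: "0 < N" "s * 4 ^ N \<le> p ^ 8 / 4" "102400 \<le> N * p ^ 32"
  shows "bergman_curvature D (a + of_real (p ^ 10)) \<le> 2 - 1 / (8704 * 2000 ^ 4 * p\<^sup>2)"
proof -
  define J where "J = (\<lambda>j. bergman_J j D (a + of_real (p ^ 10)))"
  have J0: "1 / (64 * p ^ 18) \<le> J 0" unfolding J_def by (rule inner_J0_ge)
  have J2: "1 / (136 * p ^ 40) \<le> J 2" unfolding J_def by (rule inner_J2_ge)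
  have J1: "J 1 \<le> (2000 / p ^ 14)\<^sup>2" unfolding J_def by (rule inner_J1_le[OF N])
  have pos: "0 < J 1" unfolding J_def by (intro bergman_J1_pos inner_point)
  have "1 / (8704 * 2000 ^ 4 * p\<^sup>2) = (1 / (64 * p ^ 18)) * (1 / (136 * p ^ 40)) / ((2000 / p ^ 14)\<^sup>2)\<^sup>2"
    using p_pos by (simp add: power_divide field_simps flip: power_add power_mult)
  also have "\<dots> \<le> J 0 * J 2 / (J 1)\<^sup>2"
    using J0 J1 J2 pos p_pos order_trans[OF _ J0, of 0] order_trans[OF _ J2, of 0]
    by (intro frac_le mult_mono power_mono) auto
  finally show ?thesis by (simp add: bergman_curvature_def J_def)
qed

end

subsection \<open>Choice of the holes\<close>

text \<open>Quantifying over all \<open>D\<close> that are prescribed only between radii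
  \<open>s\<close> and \<open>\<delta>\<close> allows \<open>p\<close> and \<open>s\<close> to be
  fixed before the smaller holes are chosen.\<close>

definition curvature_oscillates :: "real \<Rightarrow> real \<Rightarrow> real \<Rightarrow> real \<Rightarrow> bool" where
  "curvature_oscillates \<delta> B p s \<longleftrightarrow> (\<forall>D a. a = of_real (p ^ 8) \<longrightarrow> open D \<longrightarrow> D \<subseteq> ball 0 (1/2) \<longrightarrow>
     D \<inter> cball a (p ^ 16) = {} \<longrightarrow>
     (\<forall>w. s < cmod w \<longrightarrow> cmod w < \<delta> \<longrightarrow> w \<notin> cball a (p ^ 16) \<longrightarrow> w \<in> D) \<longrightarrow>
     (\<exists>z\<in>D. 2 - 1 / B \<le> bergman_curvature D z) \<and> (\<exists>z\<in>D. bergman_curvature D z \<le> - B))"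

text \<open>The order of choice matters: first \<open>N\<close> from \<open>\<delta>\<close> and
  \<open>B\<close>, then \<open>p\<close> small, and only then \<open>K\<close>, hence
  \<open>s\<close>, depending on \<open>p\<close>.\<close>

lemma eventually_curvature_oscillates:
  assumes \<delta>: "0 < \<delta>" "\<delta> \<le> 1/2" and B: "0 < B"
  shows "\<forall>\<^sub>F p in at_right 0. \<exists>s>0. curvature_oscillates \<delta> B p s"
proof -
  define C where "C = 51200 * (10240 * (1 + 1 / \<delta>\<^sup>2))\<^sup>2 * 2176\<^sup>2"
  have "0 < 1 + 1 / \<delta>\<^sup>2" by (intro add_pos_nonneg) auto
  then have C: "0 < C" unfolding C_def by (intro mult_pos_pos zero_less_power) auto
  \<comment> \<open>\<open>N\<close> keeps \<open>C / N\<close> below half of \<open>1 / B\<close>;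
    the other half is left for the term with \<open>p ^ 4\<close>.\<close>
  obtain N :: nat where N: "2 * C * B < N" using reals_Archimedean2 by blast
  moreover have "0 < 2 * C * B" using C B by simp
  ultimately have "0 < real N" by linarith
  then have N0: "0 < N" by simp
  have ev: "\<forall>\<^sub>F p in at_right 0. c * p ^ Suc k < e" if "0 < e" for c e :: real and k
  proof (rule order_tendstoD(2)[OF _ that])
    show "((\<lambda>p. c * p ^ Suc k) \<longlongrightarrow> 0) (at_right 0)" by (auto intro!: tendsto_eq_intros)
  qed
  have "\<forall>\<^sub>F p in at_right 0. 8 * p\<^sup>2 < \<delta>" using ev[OF \<delta>(1), of 8 1] by (simp add: numeral_2_eq_2)
  moreover have "\<forall>\<^sub>F p in at_right 0. 4 ^ Suc N * p ^ 6 < (1::real)"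
    using ev[of 1 "4 ^ Suc N" 5] by simp
  moreover have "\<forall>\<^sub>F p in at_right 0. C / \<delta>\<^sup>2 * p ^ 4 < 1 / (2 * B)"
    using ev[of "1 / (2 * B)" "C / \<delta>\<^sup>2" 3] B by simp
  moreover have "\<forall>\<^sub>F p in at_right 0. ((B + 2) * (8704 * 2000 ^ 4)) * p\<^sup>2 < 1"
    using ev[of 1 "(B + 2) * (8704 * 2000 ^ 4)" 1] by (simp add: numeral_2_eq_2)
  moreover have "\<forall>\<^sub>F p in at_right 0. (0::real) < p" by (rule eventually_at_right_less)
  ultimately show ?thesis
  proof eventually_elim
    case (elim p)
    obtain K :: nat where K: "102400 / p ^ 32 < K" using reals_Archimedean2 by blast
    moreover have "0 < 102400 / p ^ 32" using elim(5) by simp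
    ultimately have "0 < real K" by linarith
    then have "0 < K" by simp
    have K': "102400 \<le> K * p ^ 32" using K elim(5) by (simp add: field_simps)
    \<comment> \<open>Exactly \<open>K\<close> annuli of ratio 4 fit between \<open>s\<close> and
      \<open>p ^ 8 / 4\<close>.\<close>
    define s where "s = p ^ 8 / 4 / 4 ^ K"
    have s: "0 < s" "s \<le> p ^ 8 / 4" "s * 4 ^ K \<le> p ^ 8 / 4"
      using elim(5) mult_left_mono[of 1 "4 ^ K" "p ^ 8"] by (auto simp: s_def field_simps)
    have "(\<exists>z\<in>D. 2 - 1 / B \<le> bergman_curvature D z) \<and> (\<exists>z\<in>D. bergman_curvature D z \<le> - B)"
      if D: "a = of_real (p ^ 8)" "open D" "D \<subseteq> ball 0 (1/2)" "D \<inter> cball a (p ^ 16) = {}"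
        "\<forall>w. s < cmod w \<longrightarrow> cmod w < \<delta> \<longrightarrow> w \<notin> cball a (p ^ 16) \<longrightarrow> w \<in> D" for D a
    proof -
      interpret punctured_domain D a p \<delta> s
        using D elim s \<delta> by unfold_locales auto
      have "C / N \<le> 1 / (2 * B)" using N N0 B by (simp add: field_simps)
      moreover have "1 / (2 * B) + 1 / (2 * B) = 1 / B" using B by simp
      ultimately have "C / N + C / \<delta>\<^sup>2 * p ^ 4 \<le> 1 / B" using elim(3) by linarith
      moreover have "C / N + C / \<delta>\<^sup>2 * p ^ 4 =
          51200 * (1 / N + p ^ 4 / \<delta>\<^sup>2) * (10240 * (1 + 1 / \<delta>\<^sup>2))\<^sup>2 * 2176\<^sup>2"
      proof -
        have "C / N + C / \<delta>\<^sup>2 * p ^ 4 = C * (1 / N + p ^ 4 / \<delta>\<^sup>2)" by (simp add: distrib_left)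
        then show ?thesis unfolding C_def by (simp only: mult_ac)
      qed
      ultimately have 1: "2 - 1 / B \<le> bergman_curvature D (- of_real (p\<^sup>2))"
        using outer_curvature_ge[of N] N0 elim(2) by simp
      have "B + 2 \<le> 1 / (8704 * 2000 ^ 4 * p\<^sup>2)"
        using elim(4,5) by (subst pos_le_divide_eq) (simp_all add: algebra_simps)
      then have 2: "bergman_curvature D (a + of_real (p ^ 10)) \<le> - B"
        using inner_curvature_le[OF \<open>0 < K\<close> s(3) K'] by linarith
      show ?thesis using 1 2 outer_point(1) inner_point(1) by blast
    qed
    then show ?case using s(1) unfolding curvature_oscillates_def by blast
  qed
qed

theorem corollary3:
  fixes \<theta> :: real
  assumes "0 < \<theta>" and "\<theta> < 1"
  shows "\<exists>n :: nat \<Rightarrow> nat.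
    strict_mono n \<and> (\<forall>k. 0 < n k) \<and>
    (\<forall>k l. k \<noteq> l \<longrightarrow>
       cball (complex_of_real (\<theta> ^ n k)) (\<theta> ^ (2 * n k)) \<inter>
       cball (complex_of_real (\<theta> ^ n l)) (\<theta> ^ (2 * n l)) = {}) \<and>
    (\<forall>k. cball (complex_of_real (\<theta> ^ n k)) (\<theta> ^ (2 * n k)) \<subseteq> ball 0 (1/2)) \<and>
    (let D = ball 0 (1/2) - ((\<Union>k. cball (complex_of_real (\<theta> ^ n k)) (\<theta> ^ (2 * n k))) \<union> {0})
     in (SUP z\<in>D. ereal (bergman_curvature D z)) = 2 \<and>
        (INF z\<in>D. ereal (bergman_curvature D z)) = -\<infinity>)"
proof -

  \<comment> \<open>Recursive choice of exponents and inner radii\<close>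
  have lim: "(\<lambda>m. \<theta> ^ m) \<longlonglongrightarrow> 0" using assms by (intro LIMSEQ_realpow_zero) auto
  have lim8: "(\<lambda>m. \<theta> ^ (8 * m)) \<longlonglongrightarrow> 0"
    using LIMSEQ_subseq_LIMSEQ[OF lim, of "\<lambda>m. 8 * m"] by (simp add: strict_mono_def o_def)
  have small: "\<forall>\<^sub>F m in sequentially. \<theta> ^ (8 * m) < e" if "0 < e" for e
    using order_tendstoD(2)[OF lim8 that] .
  have at0: "filterlim (\<lambda>m. \<theta> ^ m) (at_right 0) sequentially"
    using lim assms by (simp add: filterlim_at)
  \<comment> \<open>In a pair \<open>(m, s)\<close> the hole is centred at
    \<open>\<theta> ^ (8 * m)\<close>, and \<open>s\<close> bounds the region left for all later
    holes.\<close>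
  define P where "P = (\<lambda>(k::nat) (m, s::real). 0 < m \<and> 0 < s \<and> \<theta> ^ (8 * m) \<le> 1/4)"
  \<comment> \<open>The factors 2 and 4 leave room for the radii of the holes. Half of the previous
    centre serves as \<open>\<delta>\<close>, since no earlier hole reaches that far
    inwards.\<close>
  define Q where "Q = (\<lambda>k (m, s) (m', s'). m < m' \<and> 2 * \<theta> ^ (8 * m') \<le> s \<and> 4 * \<theta> ^ (8 * m') \<le> \<theta> ^ (8 * m) \<and>
    curvature_oscillates (\<theta> ^ (8 * m) / 2) (real (Suc k)) (\<theta> ^ m') s')"
  obtain f where f: "\<And>k. P k (f k)" "\<And>k. Q k (f k) (f (Suc k))"
  proof -
    \<comment> \<open>The first hole carries no curvature claim, so any positive \<open>s\<close>
      can start the recursion.\<close>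
    have "\<exists>y. P 0 y"
    proof -
      obtain m where "\<theta> ^ (8 * m) < 1/4" "0 < m"
        using eventually_happens'[OF _ eventually_conj[OF small[of "1/4"] eventually_gt_at_top[of 0]]] by auto
      then show ?thesis by (intro exI[of _ "(m, 1)"]) (simp add: P_def)
    qed
    moreover have "\<exists>y'. P (Suc k) y' \<and> Q k y y'" if y: "P k y" for k y
    proof -
      obtain m s where ms: "y = (m, s)" "0 < m" "0 < s" "\<theta> ^ (8 * m) \<le> 1/4"
        using y by (auto simp: P_def)
      have pos: "0 < \<theta> ^ (8 * m)" using assms by simp
      have "\<forall>\<^sub>F m' in sequentially. \<exists>s'>0. curvature_oscillates (\<theta> ^ (8 * m) / 2) (real (Suc k)) (\<theta> ^ m') s'"
        using ms pos by (intro eventually_compose_filterlim[OF eventually_curvature_oscillates at0]) auto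
      then have "\<forall>\<^sub>F m' in sequentially. m < m' \<and> \<theta> ^ (8 * m') < s / 2 \<and> \<theta> ^ (8 * m') < \<theta> ^ (8 * m) / 4 \<and>
          (\<exists>s'>0. curvature_oscillates (\<theta> ^ (8 * m) / 2) (real (Suc k)) (\<theta> ^ m') s')"
        using ms pos by (intro eventually_conj eventually_gt_at_top small) auto
      then obtain m' s' where "m < m'" "\<theta> ^ (8 * m') < s / 2" "\<theta> ^ (8 * m') < \<theta> ^ (8 * m) / 4" "0 < s'"
          "curvature_oscillates (\<theta> ^ (8 * m) / 2) (real (Suc k)) (\<theta> ^ m') s'"
        using eventually_happens'[OF sequentially_bot] by blast
      then show ?thesis using ms by (intro exI[of _ "(m', s')"]) (simp add: P_def Q_def)
    qed
    ultimately show ?thesis using that dependent_nat_choice[of P Q] by blast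
  qed
  define m s where "m = (\<lambda>k. fst (f k))" and "s = (\<lambda>k. snd (f k))"
  define x where "x = (\<lambda>k. \<theta> ^ (8 * m k))"
  have m0: "0 < m k" and s0: "0 < s k" and x_le: "x k \<le> 1/4" for k
    using f(1)[of k] by (auto simp: P_def m_def s_def x_def split: prod.splits)
  have m_less: "m k < m (Suc k)" and x_s: "2 * x (Suc k) \<le> s k" and x_Suc: "4 * x (Suc k) \<le> x k"
    and osc: "curvature_oscillates (x k / 2) (real (Suc k)) (\<theta> ^ m (Suc k)) (s (Suc k))" for k
    using f(2)[of k] by (auto simp: Q_def m_def s_def x_def split: prod.splits)
  have m_mono: "strict_mono m" using m_less by (simp add: strict_mono_Suc_iff)
  have x0: "0 < x k" for k using assms by (simp add: x_def)
  have "x (Suc k) \<le> x k" for k using x_Suc[of k] x0[of "Suc k"] by linarith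
  then have x_dec: "x k \<le> x j" if "j \<le> k" for j k
    using lift_Suc_antimono_le[of x] that by blast
  have x_dec4: "4 * x k \<le> x j" if "j < k" for j k
    using x_dec[of "Suc j" k] x_Suc[of j] that by simp
  have x_lim: "x \<longlonglongrightarrow> 0"
    using LIMSEQ_subseq_LIMSEQ[OF lim8 m_mono] by (simp add: x_def o_def)

  \<comment> \<open>Position of the holes and openness of the domain\<close>
  define C where "C = (\<lambda>k. cball (complex_of_real (x k)) ((x k)\<^sup>2))"
  have C_bounds: "3/4 * x k \<le> cmod w" "cmod w \<le> 5/4 * x k" if "w \<in> C k" for w k
  proof -
    have "(x k)\<^sup>2 \<le> 1/4 * x k"
      unfolding power2_eq_square using x_le[of k] x0[of k] by (intro mult_right_mono) auto
    moreover have "cmod (of_real (x k) - w) \<le> (x k)\<^sup>2" using that by (simp add: C_def dist_norm)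
    moreover have "cmod (of_real (x k)) = x k" using x0[of k] by simp
    ultimately show "3/4 * x k \<le> cmod w" "cmod w \<le> 5/4 * x k"
      using norm_triangle_ineq3[of "of_real (x k)" w] by linarith+
  qed
  have C_less: "C j \<inter> C k = {}" if "j < k" for j k
    using C_bounds(1)[of _ j] C_bounds(2)[of _ k] x_dec4[OF that] x0[of j] by fastforce
  have C_disj: "C j \<inter> C k = {}" if "j \<noteq> k" for j k
    using C_less that by (metis inf_commute linorder_neqE_nat)
  have C_sub: "C k \<subseteq> ball 0 (1/2)" for k
  proof
    fix w assume "w \<in> C k"
    then show "w \<in> ball 0 (1/2)" using C_bounds(2)[of w k] x_le[of k] by simp
  qed
  define D where "D = ball 0 (1/2) - ((\<Union>k. C k) \<union> {0})"
  \<comment> \<open>The holes accumulate at 0, so openness is read off from an exhaustion: each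
    piece omits finitely many holes and a closed disc containing 0 and all the others.\<close>
  have "D = (\<Union>K. ball 0 (1/2) - (\<Union>k\<le>K. C k) - cball 0 (2 * x (Suc K)))" (is "_ = ?R")
  proof
    show "D \<subseteq> ?R"
    proof
      fix w assume w: "w \<in> D"
      then have "0 < cmod w / 2" by (simp add: D_def)
      then have "\<forall>\<^sub>F k in sequentially. x (Suc k) < cmod w / 2"
        using order_tendstoD(2)[OF LIMSEQ_Suc[OF x_lim]] by blast
      then obtain K where "x (Suc K) < cmod w / 2"
        using eventually_happens'[OF sequentially_bot] by blast
      then show "w \<in> ?R" using w by (auto simp: D_def intro!: exI[of _ K])
    qed
    show "?R \<subseteq> D"
    proof
      fix w assume "w \<in> ?R"
      then obtain K where "w \<in> ball 0 (1/2) - (\<Union>k\<le>K. C k) - cball 0 (2 * x (Suc K))" by blast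
      then have K: "w \<in> ball 0 (1/2)" "\<And>k. k \<le> K \<Longrightarrow> w \<notin> C k" "2 * x (Suc K) < cmod w" by auto
      have "w \<notin> C k" for k
      proof (cases "k \<le> K")
        case False
        then show ?thesis using C_bounds(2)[of w k] x_dec[of "Suc K" k] K(3) x0[of "Suc K"] by fastforce
      qed (use K in auto)
      moreover have "w \<noteq> 0" using K(3) x0[of "Suc K"] by auto
      ultimately show "w \<in> D" using K(1) by (simp add: D_def)
    qed
  qed
  moreover have "open ?R"
    by (intro open_UN ballI open_Diff closed_UN) (auto simp: C_def)
  ultimately have open_D: "open D" by simp

  \<comment> \<open>Points of extreme curvature at every scale\<close>
  have points: "(\<exists>z\<in>D. 2 - 1 / real (Suc k) \<le> bergman_curvature D z) \<and>
      (\<exists>z\<in>D. bergman_curvature D z \<le> - real (Suc k))" for k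
  proof -
    have p8: "(\<theta> ^ m (Suc k)) ^ 8 = x (Suc k)" and p16: "(\<theta> ^ m (Suc k)) ^ 16 = (x (Suc k))\<^sup>2"
      by (simp_all add: x_def mult.commute flip: power_mult)
    have inD: "w \<in> D" if w: "s (Suc k) < cmod w" "cmod w < x k / 2" "w \<notin> C (Suc k)" for w
    proof -
      have "w \<notin> C j" for j
      proof -
        \<comment> \<open>Earlier holes lie beyond \<open>x k / 2\<close>, later ones inside the
          disc of radius \<open>s (Suc k)\<close>.\<close>
        consider "j \<le> k" | "j = Suc k" | "Suc (Suc k) \<le> j" by linarith
        then show ?thesis
        proof cases
          case 1
          then show ?thesis using C_bounds(1)[of w j] x_dec[of j k] w x0[of k] by fastforce
        next
          case 3
          then show ?thesis
            using C_bounds(2)[of w j] x_dec[of "Suc (Suc k)" j] x_s[of "Suc k"] w x0[of "Suc (Suc k)"] by fastforce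
        qed (use w in auto)
      qed
      moreover have "w \<noteq> 0" using w s0[of "Suc k"] by auto
      moreover have "cmod w < 1/2" using w x_le[of k] by simp
      ultimately show ?thesis by (simp add: D_def)
    qed
    have sub: "D \<subseteq> ball 0 (1/2)" by (auto simp: D_def)
    have hole: "D \<inter> cball (of_real (x (Suc k))) ((x (Suc k))\<^sup>2) = {}" by (auto simp: D_def C_def)
    show ?thesis
      by (rule osc[of k, unfolded curvature_oscillates_def p8 p16, rule_format, OF refl open_D sub hole])
        (use inD in \<open>simp add: C_def\<close>)
  qed

  \<comment> \<open>Supremum and infimum\<close>
  have sup: "(SUP z\<in>D. ereal (bergman_curvature D z)) = 2"
  proof (rule antisym)
    show "(SUP z\<in>D. ereal (bergman_curvature D z)) \<le> 2"
      using bergman_curvature_le_2[OF open_D] by (intro SUP_least) simp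
    have "\<exists>z\<in>D. y < ereal (bergman_curvature D z)" if y: "y < 2" for y
    \<comment> \<open>For \<open>y = -\<infinity>\<close> any point of \<open>D\<close> serves, and
      \<open>points\<close> supplies one.\<close>
    proof (cases y)
      case (real r)
      then have "0 < 2 - r" using y by simp
      then obtain k where "1 / real (Suc k) < 2 - r" using nat_approx_posE by blast
      then have "r < 2 - 1 / real (Suc k)" by linarith
      then show ?thesis using points[of k] real by (force intro: less_le_trans)
    qed (use y points[of 0] in auto)
    then show "2 \<le> (SUP z\<in>D. ereal (bergman_curvature D z))" by (simp add: le_SUP_iff)
  qed
  have inf: "(INF z\<in>D. ereal (bergman_curvature D z)) = -\<infinity>"
  proof (rule ereal_bot)
    fix r :: real
    obtain k where "- r < real k" using reals_Archimedean2 by blast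
    then obtain z where "z \<in> D" "bergman_curvature D z \<le> r" using points[of k] by fastforce
    then show "(INF z\<in>D. ereal (bergman_curvature D z)) \<le> ereal r"
      by (meson INF_lower2 ereal_less_eq(3))
  qed
  have C_eq: "cball (complex_of_real (\<theta> ^ (8 * m k))) (\<theta> ^ (2 * (8 * m k))) = C k" for k
    by (simp add: C_def x_def mult.commute flip: power_mult)
  \<comment> \<open>The exponents are \<open>n k = 8 * m k\<close>, so that
    \<open>p = \<theta> ^ m k\<close> gives centre \<open>p ^ 8\<close> and radius
    \<open>p ^ 16\<close>.\<close>
  have "strict_mono (\<lambda>k. 8 * m k)" using m_mono by (simp add: strict_mono_def)
  then show ?thesis
    by (intro exI[of _ "\<lambda>k. 8 * m k"], unfold C_eq Let_def D_def[symmetric], intro conjI allI impI)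
      (use m0 C_disj C_sub sup inf in auto)
qed

end
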